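(* Let $n\ge 2$, and let $\mathsf{G}_n$ be a Urizen compass of length $n$, with stable $\infty$-categories $\mathbf{D}^{[i,j]}$ ($0\le i\le j\le n$) and leaves $\mathbf{D}^0,\dots,\mathbf{D}^n$. For $i=0,\dots,n$ let $\mathfrak{t}_i$ be a $t$-structure on $\mathbf{D}^i$. Then the Urizen compass induces canonical isomorphisms between the various parenthesizations of $\mathfrak{t}_0\uplus\cdots\uplus\mathfrak{t}_n$; that is, for any two complete parenthesizations $\mathfrak{P},\mathfrak{Q}$ of $n+1$ symbols, the $t$-structures $(\mathfrak{t}_0\uplus\cdots\uplus\mathfrak{t}_n)_{\mathfrak{P}}$ and $(\mathfrak{t}_0\uplus\cdots\uplus\mathfrak{t}_n)_{\mathfrak{Q}}$ on $\mathbf{D}^{[0,n]}$ coincide (as pairs of full subcategories closed under equivalence).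
   Context: **Recollement.** A recollement $(i,q)\colon\mathbf{D}^0\leftrightarrows\mathbf{D}\leftrightarrows\mathbf{D}^1$ consists of stable $\infty$-categories $\mathbf{D}^0,\mathbf{D},\mathbf{D}^1$ and functors $i\colon\mathbf{D}^0\to\mathbf{D}$, $q\colon\mathbf{D}\to\mathbf{D}^1$ such that: (1) there are adjunctions $i_L\dashv i\dashv i_R$ and $q_L\dashv q\dashv q_R$; (2) the counit $i_L i\to 1$, the unit $1\to i_R i$, the counit $q q_R\to 1$ and the unit $1\to q q_L$ are equivalences; (3) the essential image of $i$ is the full subcategory of those $X\in\mathbf{D}$ with $qX\simeq 0$; (4) the counits and units give (functorial) fiber sequences $q_Lq\to \mathrm{id}_{\mathbf{D}}\to i i_L$ and $i i_R\to\mathrm{id}_{\mathbf{D}}\to q_R q$. **Gluing.** Given such a recollement and $t$-structures $\mathfrak{t}_\alpha=(\mathbf{D}^\alpha_{\ge0},\mathbf{D}^\alpha_{<0})$ on $\mathbf{D}^\alpha$, $\alpha=0,1$, the glued $t$-structure $\mathfrak{t}_0\uplus\mathfrak{t}_1$ on $\mathbf{D}$ (a $t$-structure by the classical gluing theorem of Beilinson–Bernstein–Deligne) has classes $$\{X\in\mathbf{D}\mid qX\in\mathbf{D}^1_{\ge0},\ i_LX\in\mathbf{D}^0_{\ge0}\},\qquad \{X\in\mathbf{D}\mid qX\in\mathbf{D}^1_{<0},\ i_RX\in\mathbf{D}^0_{<0}\}.$$ **Beck–Chevalley squares.** Consider functors $a\colon\mathbf{A}\to\mathbf{B}$, $h\colon\mathbf{C}\to\mathbf{E}$,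 $g\colon\mathbf{A}\to\mathbf{C}$, $u\colon\mathbf{B}\to\mathbf{E}$ and an invertible 2-cell $\theta\colon u\circ a\cong h\circ g$, with adjunctions $a_L\dashv a\dashv a_R$, $h_L\dashv h\dashv h_R$. The square is left Beck–Chevalley if the composite $h_Lu\Rightarrow h_Lu\,a\,a_L\Rightarrow h_Lh\,g\,a_L\Rightarrow g\,a_L$ (unit of $a_L\dashv a$, then $\theta$, then counit of $h_L\dashv h$) is invertible; right Beck–Chevalley if the composite $g\,a_R\Rightarrow h_Rh\,g\,a_R\Rightarrow h_Ru\,a\,a_R\Rightarrow h_Ru$ (unit of $h\dashv h_R$, then $\theta^{-1}$, then counit of $a\dashv a_R$) is invertible; and Beck–Chevalley if it is both. **Urizen compass.** For $0\le i\le j\le n$ let $[i,j]=\{k\mid i\le k\le j\}$, and write $i$ for $[i,i]$. A Urizen compass of length $n$ ($n\ge2$) is a diagram $\mathsf{G}_n$ consisting of a stable $\infty$-category $\mathbf{D}^{[i,j]}$ for each interval $[i,j]$ with $0\le i\le j\le n$, a functor $\mathbf{D}^{[i,j]}\to\mathbf{D}^{[i,j+1]}$ whenever $j<n$ and a functor $\mathbf{D}^{[i,j]}\to\mathbf{D}^{[i+1,j]}$ whenever $i<j$, each of these functors having both a left and a right adjoint, such that: (a) for all contiguous intervals $I=[i,j]$, $J=[j+1,k]$, with union $I\cup J=[i,k]$, the composite functors $\mathbf{D}^{[i,j]}\to\cdots\to\mathbf{D}^{[i,k]}$ and $\mathbf{D}^{[i,k]}\to\cdots\to\mathbf{D}^{[j+1,k]}$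 of the diagram form a recollement $\mathbf{D}^I\leftrightarrows\mathbf{D}^{I\cup J}\leftrightarrows\mathbf{D}^J$; (b) for all $0\le i<j<n$ the square with horizontal functors $a\colon\mathbf{D}^{[i,j]}\to\mathbf{D}^{[i,j+1]}$, $h\colon\mathbf{D}^{[i+1,j]}\to\mathbf{D}^{[i+1,j+1]}$ and vertical functors $g\colon\mathbf{D}^{[i,j]}\to\mathbf{D}^{[i+1,j]}$, $u\colon\mathbf{D}^{[i,j+1]}\to\mathbf{D}^{[i+1,j+1]}$ (commuting up to a given invertible 2-cell) is Beck–Chevalley. The categories $\mathbf{D}^0,\dots,\mathbf{D}^n$ are called its leaves and $\mathbf{D}^{[0,n]}$ its root. **Parenthesizations.** Given $t$-structures $\mathfrak{t}_i$ on the leaves, every complete parenthesization $\mathfrak{P}$ of the word $\mathfrak{t}_0\uplus\cdots\uplus\mathfrak{t}_n$ defines a $t$-structure $(\mathfrak{t}_0\uplus\cdots\uplus\mathfrak{t}_n)_{\mathfrak{P}}$ on $\mathbf{D}^{[0,n]}$ by iterated gluing: a bracketed pair formed by the $t$-structures already built on $\mathbf{D}^I$ and $\mathbf{D}^J$, with $I,J$ contiguous ($I$ to the left of $J$), is glued along the recollement $\mathbf{D}^I\leftrightarrows\mathbf{D}^{I\cup J}\leftrightarrows\mathbf{D}^J$. *)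

theory Defs
  imports Main
begin

section \<open>Simplicial sets\<close>

text \<open>
  A monotone map from [m] to [n] is encoded as the sorted list of its m+1 values.
  The map induced on an n-simplex x of X by such a list a is \<open>act X n a x\<close>,
  a simplex of dimension \<open>length a - 1\<close>.
\<close>

definition ops :: "nat \<Rightarrow> nat \<Rightarrow> nat list set" where
  "ops m n = {a. length a = Suc m \<and> sorted a \<and> set a \<subseteq> {..n}}"

record 'a sset =
  cells :: "nat \<Rightarrow> 'a set"
  act :: "nat \<Rightarrow> nat list \<Rightarrow> 'a \<Rightarrow> 'a"

definition is_sset :: "'a sset \<Rightarrow> bool" where
  "is_sset X \<longleftrightarrow>
     (\<forall>m n. \<forall>a\<in>ops m n. \<forall>x\<in>cells X n. act X n a x \<in> cells X m) \<and>
     (\<forall>n. \<forall>x\<in>cells X n. act X n [0..<Suc n] x = x) \<and>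
     (\<forall>k m n. \<forall>a\<in>ops m n. \<forall>b\<in>ops k m. \<forall>x\<in>cells X n.
        act X m b (act X n a x) = act X n (map ((!) a) b) x)"

text \<open>Simplicial maps; only the values on simplices matter.\<close>

definition smap :: "'a sset \<Rightarrow> 'b sset \<Rightarrow> (nat \<Rightarrow> 'a \<Rightarrow> 'b) \<Rightarrow> bool" where
  "smap X Y f \<longleftrightarrow>
     (\<forall>n. \<forall>x\<in>cells X n. f n x \<in> cells Y n) \<and>
     (\<forall>m n. \<forall>a\<in>ops m n. \<forall>x\<in>cells X n. f m (act X n a x) = act Y n a (f n x))"

definition fcomp :: "(nat \<Rightarrow> 'b \<Rightarrow> 'c) \<Rightarrow> (nat \<Rightarrow> 'a \<Rightarrow> 'b) \<Rightarrow> nat \<Rightarrow> 'a \<Rightarrow> 'c"  (infixl "\<bullet>" 70) where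
  "g \<bullet> f = (\<lambda>n x. g n (f n x))"

definition fid :: "nat \<Rightarrow> 'a \<Rightarrow> 'a" where
  "fid = (\<lambda>n x. x)"

definition agree_on :: "'a sset \<Rightarrow> (nat \<Rightarrow> 'a \<Rightarrow> 'b) \<Rightarrow> (nat \<Rightarrow> 'a \<Rightarrow> 'b) \<Rightarrow> bool" where
  "agree_on X f g \<longleftrightarrow> (\<forall>n. \<forall>x\<in>cells X n. f n x = g n x)"

text \<open>The nerve of a poset: n-simplices are weakly increasing lists of length n+1.\<close>

definition nerve :: "'p set \<Rightarrow> ('p \<Rightarrow> 'p \<Rightarrow> bool) \<Rightarrow> 'p list sset" where
  "nerve A le =
     \<lparr> cells = (\<lambda>n. {c. length c = Suc n \<and> set c \<subseteq> A \<and> sorted_wrt le c}),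
       act = (\<lambda>n a c. map ((!) c) a) \<rparr>"

definition subsset :: "'a sset \<Rightarrow> ('a \<Rightarrow> bool) \<Rightarrow> 'a sset" where
  "subsset X P = X \<lparr> cells := (\<lambda>n. {x \<in> cells X n. P x}) \<rparr>"

definition Delta :: "nat \<Rightarrow> nat list sset" where
  "Delta n = nerve {..n} (\<le>)"

definition boundary :: "nat \<Rightarrow> nat list sset" where
  "boundary n = subsset (Delta n) (\<lambda>c. \<not> {..n} \<subseteq> set c)"

definition horn :: "nat \<Rightarrow> nat \<Rightarrow> nat list sset" where
  "horn n k = subsset (Delta n) (\<lambda>c. \<not> {..n} - {k} \<subseteq> set c)"

definition prod_sset :: "'a sset \<Rightarrow> 'b sset \<Rightarrow> ('a \<times> 'b) sset" where
  "prod_sset X Y =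
     \<lparr> cells = (\<lambda>n. cells X n \<times> cells Y n),
       act = (\<lambda>n a p. (act X n a (fst p), act Y n a (snd p))) \<rparr>"

definition opp :: "'a sset \<Rightarrow> 'a sset" where
  "opp X = X \<lparr> act := (\<lambda>n a. act X n (rev (map (\<lambda>i. n - i) a))) \<rparr>"

text \<open>
  The simplicial set of maps from X to Y. Its n-simplices are the maps from the product of X
  with the n-simplex to Y, made equal to \<open>undefined\<close> off the simplices of the product so that
  equal simplicial maps are equal as HOL functions.
\<close>

type_synonym ('a, 'b) fun_cell = "nat \<Rightarrow> 'a \<times> nat list \<Rightarrow> 'b"

definition restr :: "'a sset \<Rightarrow> (nat \<Rightarrow> 'a \<Rightarrow> 'b) \<Rightarrow> nat \<Rightarrow> 'a \<Rightarrow> 'b" where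
  "restr X f = (\<lambda>n x. if x \<in> cells X n then f n x else undefined)"

definition Fun :: "'a sset \<Rightarrow> 'b sset \<Rightarrow> ('a, 'b) fun_cell sset" where
  "Fun X Y =
     \<lparr> cells = (\<lambda>n. {F. smap (prod_sset X (Delta n)) Y F \<and> F = restr (prod_sset X (Delta n)) F}),
       act = (\<lambda>n a F. restr (prod_sset X (Delta (length a - 1)))
                (\<lambda>k p. F k (fst p, map ((!) a) (snd p)))) \<rparr>"

text \<open>A map from X to Y as a vertex of \<open>Fun X Y\<close>.\<close>

definition fvertex :: "'a sset \<Rightarrow> (nat \<Rightarrow> 'a \<Rightarrow> 'b) \<Rightarrow> ('a, 'b) fun_cell" where
  "fvertex X f = restr (prod_sset X (Delta 0)) (\<lambda>k p. f k (fst p))"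


section \<open>Quasi-categories\<close>

definition quasicategory :: "'a sset \<Rightarrow> bool" where
  "quasicategory C \<longleftrightarrow> is_sset C \<and>
     (\<forall>n k f. 0 < k \<and> k < n \<and> smap (horn n k) C f \<longrightarrow>
        (\<exists>g. smap (Delta n) C g \<and> agree_on (horn n k) g f))"

abbreviation obj :: "'a sset \<Rightarrow> 'a set" where
  "obj C \<equiv> cells C 0"

definition edge :: "'a sset \<Rightarrow> 'a \<Rightarrow> 'a \<Rightarrow> 'a \<Rightarrow> bool" where
  "edge C x y f \<longleftrightarrow> f \<in> cells C 1 \<and> act C 1 [0] f = x \<and> act C 1 [1] f = y"

definition ident :: "'a sset \<Rightarrow> 'a \<Rightarrow> 'a" where
  "ident C x = act C 0 [0, 0] x"

text \<open>\<open>composite C u v w\<close>: some 2-simplex exhibits w as a composite of u followed by v.\<close>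

definition composite :: "'a sset \<Rightarrow> 'a \<Rightarrow> 'a \<Rightarrow> 'a \<Rightarrow> bool" where
  "composite C u v w \<longleftrightarrow>
     (\<exists>s\<in>cells C 2. act C 2 [0, 1] s = u \<and> act C 2 [1, 2] s = v \<and> act C 2 [0, 2] s = w)"

definition composite3 :: "'a sset \<Rightarrow> 'a \<Rightarrow> 'a \<Rightarrow> 'a \<Rightarrow> 'a \<Rightarrow> bool" where
  "composite3 C u v w r \<longleftrightarrow> (\<exists>p. composite C u v p \<and> composite C p w r)"

definition homotopic :: "'a sset \<Rightarrow> 'a \<Rightarrow> 'a \<Rightarrow> bool" where
  "homotopic C f g \<longleftrightarrow> composite C f (ident C (act C 1 [1] f)) g"

definition inverse_edges :: "'a sset \<Rightarrow> 'a \<Rightarrow> 'a \<Rightarrow> bool" where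
  "inverse_edges C f g \<longleftrightarrow>
     composite C f g (ident C (act C 1 [0] f)) \<and> composite C g f (ident C (act C 1 [1] f))"

definition equivalence :: "'a sset \<Rightarrow> 'a \<Rightarrow> bool" where
  "equivalence C f \<longleftrightarrow> (\<exists>g. inverse_edges C f g)"

definition equivalent :: "'a sset \<Rightarrow> 'a \<Rightarrow> 'a \<Rightarrow> bool" where
  "equivalent C x y \<longleftrightarrow> (\<exists>f. edge C x y f \<and> equivalence C f)"


section \<open>Limits and stable quasi-categories\<close>

definition final_obj :: "'a sset \<Rightarrow> 'a \<Rightarrow> bool" where
  "final_obj C z \<longleftrightarrow> z \<in> obj C \<and>
     (\<forall>n f. 0 < n \<and> smap (boundary n) C f \<and> f 0 [n] = z \<longrightarrow>
        (\<exists>g. smap (Delta n) C g \<and> agree_on (boundary n) g f))"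

definition initial_obj :: "'a sset \<Rightarrow> 'a \<Rightarrow> bool" where
  "initial_obj C z \<longleftrightarrow> final_obj (opp C) z"

definition zero_obj :: "'a sset \<Rightarrow> 'a \<Rightarrow> bool" where
  "zero_obj C z \<longleftrightarrow> initial_obj C z \<and> final_obj C z"

text \<open>
  The join of the n-simplex with the nerve of a poset J, and the join of the boundary of the
  n-simplex with that nerve.
\<close>

fun join_le :: "('j \<Rightarrow> 'j \<Rightarrow> bool) \<Rightarrow> nat + 'j \<Rightarrow> nat + 'j \<Rightarrow> bool" where
  "join_le le (Inl k) (Inl l) = (k \<le> l)"
| "join_le le (Inl k) (Inr j) = True"
| "join_le le (Inr i) (Inl l) = False"
| "join_le le (Inr i) (Inr j) = le i j"

definition join :: "nat \<Rightarrow> 'j set \<Rightarrow> ('j \<Rightarrow> 'j \<Rightarrow> bool) \<Rightarrow> (nat + 'j) list sset" where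
  "join n J le = nerve (Inl ` {..n} \<union> Inr ` J) (join_le le)"

definition boundary_join :: "nat \<Rightarrow> 'j set \<Rightarrow> ('j \<Rightarrow> 'j \<Rightarrow> bool) \<Rightarrow> (nat + 'j) list sset" where
  "boundary_join n J le = subsset (join n J le) (\<lambda>c. \<not> Inl ` {..n} \<subseteq> set c)"

text \<open>
  A cone p over a J-shaped diagram is a limit cone if it is a final object of the slice
  quasi-category over the diagram. An n-simplex of that slice is a map from the join of the
  n-simplex with J that restricts to the diagram on J, so finality is the lifting property below.
\<close>

definition limit_cone ::
    "'a sset \<Rightarrow> 'j set \<Rightarrow> ('j \<Rightarrow> 'j \<Rightarrow> bool) \<Rightarrow> (nat \<Rightarrow> (nat + 'j) list \<Rightarrow> 'a) \<Rightarrow> bool" where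
  "limit_cone C J le p \<longleftrightarrow> smap (join 0 J le) C p \<and>
     (\<forall>n f. 0 < n \<and> smap (boundary_join n J le) C f \<and>
        agree_on (join 0 J le) (\<lambda>m c. f m (map (map_sum (\<lambda>_. n) id) c)) p \<longrightarrow>
        (\<exists>g. smap (join n J le) C g \<and> agree_on (boundary_join n J le) g f))"

text \<open>
  Squares are maps out of the nerve of the product poset of {0,1} with itself, which is the cone
  on the cospan (1,0), (0,1) over (1,1) with cone point (0,0).
\<close>

definition le2 :: "nat \<times> nat \<Rightarrow> nat \<times> nat \<Rightarrow> bool" where
  "le2 p q \<longleftrightarrow> fst p \<le> fst q \<and> snd p \<le> snd q"

definition Square :: "(nat \<times> nat) list sset" where
  "Square = nerve ({0, 1} \<times> {0, 1}) le2"

definition pullback :: "'a sset \<Rightarrow> (nat \<Rightarrow> (nat \<times> nat) list \<Rightarrow> 'a) \<Rightarrow> bool" where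
  "pullback C s \<longleftrightarrow> smap Square C s \<and>
     limit_cone C {(1, 0), (0, 1), (1, 1)} le2
       (\<lambda>m c. s m (map (case_sum (\<lambda>_. (0, 0)) id) c))"

definition pushout :: "'a sset \<Rightarrow> (nat \<Rightarrow> (nat \<times> nat) list \<Rightarrow> 'a) \<Rightarrow> bool" where
  "pushout C s \<longleftrightarrow> pullback (opp C) (\<lambda>m c. s m (rev (map (\<lambda>(a, b). (1 - a, 1 - b)) c)))"

definition triangle :: "'a sset \<Rightarrow> (nat \<Rightarrow> (nat \<times> nat) list \<Rightarrow> 'a) \<Rightarrow> bool" where
  "triangle C s \<longleftrightarrow> smap Square C s \<and> zero_obj C (s 0 [(0, 1)])"

text \<open>The edges u and v are part of a fiber sequence.\<close>

definition fiber_seq :: "'a sset \<Rightarrow> 'a \<Rightarrow> 'a \<Rightarrow> bool" where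
  "fiber_seq C u v \<longleftrightarrow>
     (\<exists>s. triangle C s \<and> pullback C s \<and> s 1 [(0, 0), (1, 0)] = u \<and> s 1 [(1, 0), (1, 1)] = v)"

definition stable :: "'a sset \<Rightarrow> bool" where
  "stable C \<longleftrightarrow> quasicategory C \<and> (\<exists>z. zero_obj C z) \<and>
     (\<forall>f\<in>cells C 1.
        (\<exists>s. triangle C s \<and> pullback C s \<and> s 1 [(1, 0), (1, 1)] = f) \<and>
        (\<exists>s. triangle C s \<and> pushout C s \<and> s 1 [(0, 0), (1, 0)] = f)) \<and>
     (\<forall>s. triangle C s \<longrightarrow> (pullback C s \<longleftrightarrow> pushout C s))"

definition suspension :: "'a sset \<Rightarrow> 'a \<Rightarrow> 'a \<Rightarrow> bool" where
  "suspension C x y \<longleftrightarrow>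
     (\<exists>s. triangle C s \<and> zero_obj C (s 0 [(1, 0)]) \<and> pushout C s \<and>
          s 0 [(0, 0)] = x \<and> s 0 [(1, 1)] = y)"

definition loop_obj :: "'a sset \<Rightarrow> 'a \<Rightarrow> 'a \<Rightarrow> bool" where
  "loop_obj C y x \<longleftrightarrow>
     (\<exists>s. triangle C s \<and> zero_obj C (s 0 [(1, 0)]) \<and> pullback C s \<and>
          s 0 [(0, 0)] = x \<and> s 0 [(1, 1)] = y)"


section \<open>t-structures\<close>

text \<open>
  A pair of full subcategories is a pair of sets of objects; the pair (A, B) stands for
  the aisle A of objects "at least 0" and the coaisle B of objects "less than 0".
\<close>

type_synonym 'a tpair = "'a set \<times> 'a set"

definition replete :: "'a sset \<Rightarrow> 'a set \<Rightarrow> bool" where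
  "replete C A \<longleftrightarrow> A \<subseteq> obj C \<and> (\<forall>x\<in>A. \<forall>y\<in>obj C. equivalent C x y \<longrightarrow> y \<in> A)"

text \<open>
  Orthogonality: hom-groups of the homotopy category from A to B vanish, that is, any two
  parallel edges from A to B are homotopic.
\<close>

definition t_structure :: "'a sset \<Rightarrow> 'a tpair \<Rightarrow> bool" where
  "t_structure C t \<longleftrightarrow> (case t of (A, B) \<Rightarrow>
     replete C A \<and> replete C B \<and>
     (\<forall>x\<in>A. \<forall>y\<in>B. \<forall>f g. edge C x y f \<and> edge C x y g \<longrightarrow> homotopic C f g) \<and>
     (\<forall>x\<in>A. \<forall>y. suspension C x y \<longrightarrow> y \<in> A) \<and>
     (\<forall>y\<in>B. \<forall>x. loop_obj C y x \<longrightarrow> x \<in> B) \<and>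
     (\<forall>x\<in>obj C. \<exists>a\<in>A. \<exists>b\<in>B. \<exists>u v. edge C a x u \<and> edge C x b v \<and> fiber_seq C u v))"


section \<open>Natural transformations and adjunctions\<close>

text \<open>
  A natural transformation from f to g is an edge of \<open>Fun C D\<close> between the corresponding vertices.
  \<open>postw X g u\<close> is the whiskering of u by g after it, \<open>prew W f u\<close> by f before it; X resp. W is
  the source of the resulting transformation.
\<close>

definition nat_trans ::
    "'a sset \<Rightarrow> 'b sset \<Rightarrow> (nat \<Rightarrow> 'a \<Rightarrow> 'b) \<Rightarrow> (nat \<Rightarrow> 'a \<Rightarrow> 'b) \<Rightarrow> ('a, 'b) fun_cell \<Rightarrow> bool" where
  "nat_trans C D f g u \<longleftrightarrow> edge (Fun C D) (fvertex C f) (fvertex C g) u"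

definition postw ::
    "'a sset \<Rightarrow> (nat \<Rightarrow> 'b \<Rightarrow> 'c) \<Rightarrow> ('a, 'b) fun_cell \<Rightarrow> ('a, 'c) fun_cell" where
  "postw X g u = restr (prod_sset X (Delta 1)) (\<lambda>k p. g k (u k p))"

definition prew ::
    "'w sset \<Rightarrow> (nat \<Rightarrow> 'w \<Rightarrow> 'a) \<Rightarrow> ('a, 'b) fun_cell \<Rightarrow> ('w, 'b) fun_cell" where
  "prew W f u = restr (prod_sset W (Delta 1)) (\<lambda>k p. u k (f k (fst p), snd p))"

text \<open>f is left adjoint to g, with unit \<open>eta\<close> and counit \<open>eps\<close>; triangle identities up to homotopy.\<close>

definition adjunction ::
    "'a sset \<Rightarrow> 'b sset \<Rightarrow> (nat \<Rightarrow> 'a \<Rightarrow> 'b) \<Rightarrow> (nat \<Rightarrow> 'b \<Rightarrow> 'a) \<Rightarrow>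
     ('a, 'a) fun_cell \<Rightarrow> ('b, 'b) fun_cell \<Rightarrow> bool" where
  "adjunction C D f g eta eps \<longleftrightarrow>
     smap C D f \<and> smap D C g \<and>
     nat_trans C C fid (g \<bullet> f) eta \<and> nat_trans D D (f \<bullet> g) fid eps \<and>
     composite (Fun C D) (postw C f eta) (prew C f eps) (ident (Fun C D) (fvertex C f)) \<and>
     composite (Fun D C) (prew D g eta) (postw D g eps) (ident (Fun D C) (fvertex D g))"

definition adjoint_pair ::
    "'a sset \<Rightarrow> 'b sset \<Rightarrow> (nat \<Rightarrow> 'a \<Rightarrow> 'b) \<Rightarrow> (nat \<Rightarrow> 'b \<Rightarrow> 'a) \<Rightarrow> bool" where
  "adjoint_pair C D f g \<longleftrightarrow> (\<exists>eta eps. adjunction C D f g eta eps)"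

text \<open>A chosen left (right) adjoint of a functor f from C to D. Adjoints are unique up to equivalence, so
  membership of values in subcategories closed under equivalence does not depend on the choice.\<close>

definition left_adj :: "'a sset \<Rightarrow> 'b sset \<Rightarrow> (nat \<Rightarrow> 'a \<Rightarrow> 'b) \<Rightarrow> nat \<Rightarrow> 'b \<Rightarrow> 'a" where
  "left_adj C D f = (SOME l. adjoint_pair D C l f)"

definition right_adj :: "'a sset \<Rightarrow> 'b sset \<Rightarrow> (nat \<Rightarrow> 'a \<Rightarrow> 'b) \<Rightarrow> nat \<Rightarrow> 'b \<Rightarrow> 'a" where
  "right_adj C D f = (SOME r. adjoint_pair C D f r)"


section \<open>Recollements, gluing and Beck-Chevalley squares\<close>

definition recollement ::
    "'a sset \<Rightarrow> 'b sset \<Rightarrow> 'c sset \<Rightarrow> (nat \<Rightarrow> 'a \<Rightarrow> 'b) \<Rightarrow> (nat \<Rightarrow> 'b \<Rightarrow> 'c) \<Rightarrow> bool" where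
  "recollement D0 D D1 i q \<longleftrightarrow>
     stable D0 \<and> stable D \<and> stable D1 \<and> smap D0 D i \<and> smap D D1 q \<and>
     (\<exists>iL iR qL qR eta_iL eps_iL eta_iR eps_iR eta_qL eps_qL eta_qR eps_qR.
        adjunction D D0 iL i eta_iL eps_iL \<and> adjunction D0 D i iR eta_iR eps_iR \<and>
        adjunction D1 D qL q eta_qL eps_qL \<and> adjunction D D1 q qR eta_qR eps_qR \<and>
        equivalence (Fun D0 D0) eps_iL \<and> equivalence (Fun D0 D0) eta_iR \<and>
        equivalence (Fun D1 D1) eps_qR \<and> equivalence (Fun D1 D1) eta_qL \<and>
        (\<forall>x\<in>obj D. (\<exists>y\<in>obj D0. equivalent D (i 0 y) x) \<longleftrightarrow> zero_obj D1 (q 0 x)) \<and>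
        fiber_seq (Fun D D) eps_qL eta_iL \<and>
        fiber_seq (Fun D D) eps_iR eta_qR)"

definition glue ::
    "'a sset \<Rightarrow> 'b sset \<Rightarrow> 'c sset \<Rightarrow> (nat \<Rightarrow> 'a \<Rightarrow> 'b) \<Rightarrow> (nat \<Rightarrow> 'b \<Rightarrow> 'c) \<Rightarrow>
     'a tpair \<Rightarrow> 'c tpair \<Rightarrow> 'b tpair" where
  "glue D0 D D1 i q t0 t1 =
     ({x \<in> obj D. q 0 x \<in> fst t1 \<and> left_adj D0 D i 0 x \<in> fst t0},
      {x \<in> obj D. q 0 x \<in> snd t1 \<and> right_adj D0 D i 0 x \<in> snd t0})"

text \<open>Squares with horizontal functors a, h, vertical functors g, u and a 2-cell from ua to hg.\<close>

definition left_BC ::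
    "'a sset \<Rightarrow> 'b sset \<Rightarrow> 'c sset \<Rightarrow> 'e sset \<Rightarrow> (nat \<Rightarrow> 'a \<Rightarrow> 'b) \<Rightarrow> (nat \<Rightarrow> 'c \<Rightarrow> 'e) \<Rightarrow>
     (nat \<Rightarrow> 'a \<Rightarrow> 'c) \<Rightarrow> (nat \<Rightarrow> 'b \<Rightarrow> 'e) \<Rightarrow> ('a, 'e) fun_cell \<Rightarrow> bool" where
  "left_BC A B C E a h g u \<theta> \<longleftrightarrow>
     (\<exists>aL hL eta_a eps_a eta_h eps_h m.
        adjunction B A aL a eta_a eps_a \<and> adjunction E C hL h eta_h eps_h \<and>
        composite3 (Fun B C) (postw B (hL \<bullet> u) eta_a) (postw B hL (prew B aL \<theta>))
          (prew B (g \<bullet> aL) eps_h) m \<and>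
        equivalence (Fun B C) m)"

definition right_BC ::
    "'a sset \<Rightarrow> 'b sset \<Rightarrow> 'c sset \<Rightarrow> 'e sset \<Rightarrow> (nat \<Rightarrow> 'a \<Rightarrow> 'b) \<Rightarrow> (nat \<Rightarrow> 'c \<Rightarrow> 'e) \<Rightarrow>
     (nat \<Rightarrow> 'a \<Rightarrow> 'c) \<Rightarrow> (nat \<Rightarrow> 'b \<Rightarrow> 'e) \<Rightarrow> ('a, 'e) fun_cell \<Rightarrow> bool" where
  "right_BC A B C E a h g u \<theta> \<longleftrightarrow>
     (\<exists>aR hR eta_a eps_a eta_h eps_h \<theta>' m.
        adjunction A B a aR eta_a eps_a \<and> adjunction C E h hR eta_h eps_h \<and>
        inverse_edges (Fun A E) \<theta> \<theta>' \<and>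
        composite3 (Fun B C) (prew B (g \<bullet> aR) eta_h) (postw B hR (prew B aR \<theta>'))
          (postw B (hR \<bullet> u) eps_a) m \<and>
        equivalence (Fun B C) m)"

definition BC_square ::
    "'a sset \<Rightarrow> 'b sset \<Rightarrow> 'c sset \<Rightarrow> 'e sset \<Rightarrow> (nat \<Rightarrow> 'a \<Rightarrow> 'b) \<Rightarrow> (nat \<Rightarrow> 'c \<Rightarrow> 'e) \<Rightarrow>
     (nat \<Rightarrow> 'a \<Rightarrow> 'c) \<Rightarrow> (nat \<Rightarrow> 'b \<Rightarrow> 'e) \<Rightarrow> ('a, 'e) fun_cell \<Rightarrow> bool" where
  "BC_square A B C E a h g u \<theta> \<longleftrightarrow>
     nat_trans A E (u \<bullet> a) (h \<bullet> g) \<theta> \<and> equivalence (Fun A E) \<theta> \<and>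
     left_BC A B C E a h g u \<theta> \<and> right_BC A B C E a h g u \<theta>"


section \<open>Urizen compasses and parenthesizations\<close>

text \<open>
  \<open>cat G i j\<close> is the category on the interval [i,j]; \<open>inc G i j\<close> goes from [i,j] to [i,j+1],
  \<open>res G i j\<close> from [i,j] to [i+1,j], and \<open>cell2 G i j\<close> is the 2-cell of the square on
  [i,j], [i,j+1], [i+1,j], [i+1,j+1]. Values at other indices are irrelevant. That all simplices
  lie in one type is no restriction: pass to a disjoint union.
\<close>

record 'a compass =
  cat :: "nat \<Rightarrow> nat \<Rightarrow> 'a sset"
  inc :: "nat \<Rightarrow> nat \<Rightarrow> nat \<Rightarrow> 'a \<Rightarrow> 'a"
  res :: "nat \<Rightarrow> nat \<Rightarrow> nat \<Rightarrow> 'a \<Rightarrow> 'a"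
  cell2 :: "nat \<Rightarrow> nat \<Rightarrow> ('a, 'a) fun_cell"

text \<open>\<open>incs G i j d\<close> is the composite from [i,j] to [i,j+d], \<open>ress G i k d\<close> from [i,k] to [i+d,k].\<close>

primrec incs :: "'a compass \<Rightarrow> nat \<Rightarrow> nat \<Rightarrow> nat \<Rightarrow> nat \<Rightarrow> 'a \<Rightarrow> 'a" where
  "incs G i j 0 = fid"
| "incs G i j (Suc d) = inc G i (j + d) \<bullet> incs G i j d"

primrec ress :: "'a compass \<Rightarrow> nat \<Rightarrow> nat \<Rightarrow> nat \<Rightarrow> nat \<Rightarrow> 'a \<Rightarrow> 'a" where
  "ress G i k 0 = fid"
| "ress G i k (Suc d) = res G (i + d) k \<bullet> ress G i k d"

definition biadjoint :: "'a sset \<Rightarrow> 'b sset \<Rightarrow> (nat \<Rightarrow> 'a \<Rightarrow> 'b) \<Rightarrow> bool" where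
  "biadjoint C D f \<longleftrightarrow> smap C D f \<and> (\<exists>l. adjoint_pair D C l f) \<and> (\<exists>r. adjoint_pair C D f r)"

definition urizen_compass :: "nat \<Rightarrow> 'a compass \<Rightarrow> bool" where
  "urizen_compass n G \<longleftrightarrow>
     (\<forall>i j. i \<le> j \<and> j \<le> n \<longrightarrow> stable (cat G i j)) \<and>
     (\<forall>i j. i \<le> j \<and> j < n \<longrightarrow> biadjoint (cat G i j) (cat G i (j + 1)) (inc G i j)) \<and>
     (\<forall>i j. i < j \<and> j \<le> n \<longrightarrow> biadjoint (cat G i j) (cat G (i + 1) j) (res G i j)) \<and>
     (\<forall>i j k. i \<le> j \<and> j < k \<and> k \<le> n \<longrightarrow>
        recollement (cat G i j) (cat G i k) (cat G (j + 1) k)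
          (incs G i j (k - j)) (ress G i k (j + 1 - i))) \<and>
     (\<forall>i j. i < j \<and> j < n \<longrightarrow>
        BC_square (cat G i j) (cat G i (j + 1)) (cat G (i + 1) j) (cat G (i + 1) (j + 1))
          (inc G i j) (inc G (i + 1) j) (res G i j) (res G i (j + 1)) (cell2 G i j))"

datatype paren = Sym | Pair paren paren

primrec symbols :: "paren \<Rightarrow> nat" where
  "symbols Sym = 1"
| "symbols (Pair P Q) = symbols P + symbols Q"

text \<open>
  \<open>glued G t i P\<close> is built from \<open>t i, t (i+1), \<dots>\<close> by the bracketing P; it lives on the interval
  of length \<open>symbols P\<close> starting at i.
\<close>

primrec glued :: "'a compass \<Rightarrow> (nat \<Rightarrow> 'a tpair) \<Rightarrow> nat \<Rightarrow> paren \<Rightarrow> 'a tpair" where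
  "glued G t i Sym = t i"
| "glued G t i (Pair P Q) =
     (let j = i + symbols P - 1; k = i + symbols P + symbols Q - 1 in
      glue (cat G i j) (cat G i k) (cat G (j + 1) k)
        (incs G i j (k - j)) (ress G i k (j + 1 - i))
        (glued G t i P) (glued G t (i + symbols P) Q))"

end

theory Submission
  imports Defs
begin

text \<open>
  The aisle produced by any bracketing of the word \<open>t\<^sub>0 \<dots> t\<^sub>n\<close> has a description that does not
  mention the bracketing: an object \<open>x\<close> belongs to it if and only if, for every leaf \<open>m\<close>, restricting
  \<open>x\<close> to \<open>[m,n]\<close> and applying the left adjoint of \<open>[m,m] \<rightarrow> [m,n]\<close> gives an object of the aisle of
  \<open>t\<^sub>m\<close>. The coaisle has the same description with right adjoints (\<open>leafwise\<close>, \<open>glued_leafwise\<close>).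

  The proof is by induction on the bracketing, for all subintervals. Gluing along
  \<open>[i,j], [i,k], [j+1,k]\<close> tests the restriction of \<open>x\<close> to \<open>[j+1,k]\<close> and the reflection \<open>l x\<close> in
  \<open>[i,j]\<close>. For a leaf of \<open>[j+1,k]\<close> the test is already the one on \<open>[i,k]\<close>, as restrictions compose.
  For a leaf \<open>m\<close> of \<open>[i,j]\<close> one has to compare reflecting \<open>x\<close> to \<open>[i,j]\<close>, restricting to \<open>[m,j]\<close> and
  reflecting to \<open>[m,m]\<close> with restricting \<open>x\<close> to \<open>[m,k]\<close> and reflecting to \<open>[m,m]\<close>. The Beck-Chevalley
  condition interchanges the first two steps, and left adjoints compose.

  All this takes place up to equivalence of objects, and the classes involved are closed under
  equivalence, so the argument can be run in homotopy categories, where a Beck-Chevalley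
  transformation amounts to the equivalences between objects given by its components. It is convenient
  to replace functors that are adjoint to \<open>f\<close> by their values, characterized by universal arrows: \<open>y\<close>
  represents \<open>x\<close> along \<open>f\<close> if some \<open>x \<rightarrow> f y\<close> is initial, up to homotopy, among arrows from \<open>x\<close> to
  values of \<open>f\<close>. Such \<open>y\<close> are unique up to equivalence
  (\<open>universal_unique\<close>), compose (\<open>universal_comp\<close>), are supplied by any adjunction
  (\<open>adj_universal\<close>) and are preserved by the vertical functors of a Beck-Chevalley square
  (\<open>BC_square_universal\<close>).

  The homotopy category enters through the relation \<open>composite\<close> alone. Inner horns of dimensions 2
  and 3 give existence of composites and associativity (\<open>composite_exists\<close>, \<open>composite_assoc\<close>), and
  with the identities they make \<open>composite\<close> behave as a category up to homotopy. Its laws are symmetric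
  under reversal of arrows, which lets one argument treat left adjoints with aisles and right adjoints
  with coaisles.
\<close>

section \<open>Filling inner horns\<close>

text \<open>
  The coface from [n-1] to [n] that omits i, as its list of values. The value function
  \<open>squeeze i\<close> below is inverse to it away from i.
\<close>

definition delta :: "nat \<Rightarrow> nat \<Rightarrow> nat list" where
  "delta n i = map (\<lambda>v. if v < i then v else Suc v) [0..<n]"

definition squeeze :: "nat \<Rightarrow> nat \<Rightarrow> nat" where
  "squeeze i v = (if v < i then v else v - 1)"

lemma is_ssetD:
  assumes "is_sset X"
  shows act_cells: "a \<in> ops m n \<Longrightarrow> x \<in> cells X n \<Longrightarrow> act X n a x \<in> cells X m"
    and act_id: "x \<in> cells X n \<Longrightarrow> act X n [0..<Suc n] x = x"
    and act_act: "a \<in> ops m n \<Longrightarrow> b \<in> ops k m \<Longrightarrow> x \<in> cells X n \<Longrightarrow>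
        act X m b (act X n a x) = act X n (map ((!) a) b) x"
  using assms unfolding is_sset_def by blast+

lemma smapD:
  assumes "smap X Y f"
  shows smap_cells: "x \<in> cells X n \<Longrightarrow> f n x \<in> cells Y n"
    and smap_act: "a \<in> ops m n \<Longrightarrow> x \<in> cells X n \<Longrightarrow> f m (act X n a x) = act Y n a (f n x)"
  using assms unfolding smap_def by blast+

lemma Delta_cells: "cells (Delta n) m = ops m n"
  by (auto simp: Delta_def nerve_def ops_def)

lemma Delta_act: "act (Delta n) m a c = map ((!) c) a"
  by (simp add: Delta_def nerve_def)

lemma horn_cells: "cells (horn n k) m = {c \<in> ops m n. \<exists>i\<le>n. i \<noteq> k \<and> i \<notin> set c}"
  by (auto simp: horn_def subsset_def Delta_cells)

lemma horn_act: "act (horn n k) m a c = map ((!) c) a"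
  by (simp add: horn_def subsset_def Delta_act)

lemma ops_comp:
  assumes a: "a \<in> ops m n" and b: "b \<in> ops k m"
  shows "map ((!) a) b \<in> ops k n"
proof -
  have "sorted b" and le: "\<And>v. v \<in> set b \<Longrightarrow> v < length a"
    using a b by (force simp: ops_def)+
  have "sorted_wrt (\<lambda>v w. a ! v \<le> a ! w) b"
    using a le by (intro sorted_wrt_mono_rel[OF _ \<open>sorted b\<close>]) (auto simp: ops_def intro!: sorted_nth_mono)
  moreover have "a ! v \<le> n" if "v \<in> set b" for v
    using nth_mem[OF le[OF that]] a by (auto simp: ops_def)
  ultimately show ?thesis using b by (auto simp: ops_def sorted_map)
qed

lemma set_comp_subset: "a \<in> ops m n \<Longrightarrow> b \<in> ops k m \<Longrightarrow> set (map ((!) a) b) \<subseteq> set a"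
  by (force simp: ops_def)

lemma delta_ops: "0 < n \<Longrightarrow> delta n i \<in> ops (n - 1) n"
  by (auto simp: ops_def delta_def sorted_iff_nth_mono)

lemma delta_misses: "i \<notin> set (delta n i)"
  by (auto simp: delta_def)

lemma squeeze_ops:
  assumes "c \<in> ops m (Suc n)" "i \<notin> set c" "i \<le> Suc n"
  shows "map (squeeze i) c \<in> ops m n"
proof -
  have "sorted (map (squeeze i) c)"
    using assms(1) unfolding ops_def sorted_map
    by (auto simp: squeeze_def elim!: sorted_wrt_mono_rel[rotated])
  moreover have "squeeze i v \<le> n" if "v \<in> set c" for v
    using that assms unfolding ops_def squeeze_def by (cases "v = i") force+
  ultimately show ?thesis using assms(1) by (auto simp: ops_def)
qed

lemma delta_squeeze:
  assumes "c \<in> ops m n" "i \<notin> set c" "i \<le> n"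
  shows "map ((!) (delta n i)) (map (squeeze i) c) = c"
proof -
  have "delta n i ! squeeze i v = v" if "v \<in> set c" for v
  proof -
    have "v \<noteq> i" "v \<le> n" using that assms by (auto simp: ops_def)
    then show ?thesis using assms(3) by (auto simp: delta_def squeeze_def)
  qed
  then show ?thesis by (simp add: map_idI)
qed

lemma squeeze_delta: "map (squeeze i) (delta n i) = [0..<n]"
  by (auto simp: delta_def squeeze_def intro!: map_idI)

text \<open>
  A map out of a horn is determined by its faces, and any family of faces that agree on the common
  faces of codimension 2 arises from one. A simplex \<open>c\<close> of the horn omits some vertex \<open>i \<noteq> k\<close>; the map
  sends it to the corresponding simplex of the face \<open>s i\<close>. If \<open>c\<close> omits both \<open>i\<close> and \<open>j\<close>, it lies in
  a codimension-2 face, so compatibility makes the value independent of the choice.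
\<close>

lemma inner_horn_filler:
  assumes C: "quasicategory C" and k: "0 < k" "k < Suc (Suc n)"
    and face: "\<And>i. i \<le> Suc (Suc n) \<Longrightarrow> i \<noteq> k \<Longrightarrow> s i \<in> cells C (Suc n)"
    and compat: "\<And>i j. i < j \<Longrightarrow> j \<le> Suc (Suc n) \<Longrightarrow> i \<noteq> k \<Longrightarrow> j \<noteq> k \<Longrightarrow>
        act C (Suc n) (delta (Suc n) i) (s j) = act C (Suc n) (delta (Suc n) (j - 1)) (s i)"
  shows "\<exists>x\<in>cells C (Suc (Suc n)).
    \<forall>i\<le>Suc (Suc n). i \<noteq> k \<longrightarrow> act C (Suc (Suc n)) (delta (Suc (Suc n)) i) x = s i"
proof -
  let ?N = "Suc (Suc n)"
  let ?miss = "\<lambda>c i. i \<le> ?N \<and> i \<noteq> k \<and> i \<notin> set c"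
  have X: "is_sset C" using C by (simp add: quasicategory_def)
  define val where "val i c = act C (Suc n) (map (squeeze i) c) (s i)" for i c
  have val_less: "val i c = val j c"
    if c: "c \<in> ops m ?N" and i: "?miss c i" and j: "?miss c j" and "i < j" for c m i j
  proof -
    have ci: "map (squeeze i) c \<in> ops m (Suc n)" and cj: "map (squeeze j) c \<in> ops m (Suc n)"
      using c i j by (auto intro: squeeze_ops)
    have ne: "i \<noteq> squeeze j v" "j - 1 \<noteq> squeeze i v" if "v \<in> set c" for v
    proof -
      have "v \<noteq> i" "v \<noteq> j" using that i j by auto
      then show "i \<noteq> squeeze j v" "j - 1 \<noteq> squeeze i v" using \<open>i < j\<close> by (auto simp: squeeze_def)
    qed
    then have mi: "i \<notin> set (map (squeeze j) c)" and mj: "j - 1 \<notin> set (map (squeeze i) c)"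
      by auto
    have swap: "map (squeeze i) (map (squeeze j) c) = map (squeeze (j - 1)) (map (squeeze i) c)"
    proof -
      have "squeeze i (squeeze j v) = squeeze (j - 1) (squeeze i v)" if "v \<in> set c" for v
      proof -
        have "v \<noteq> i" "v \<noteq> j" using that i j by auto
        then show ?thesis using \<open>i < j\<close> unfolding squeeze_def by auto
      qed
      then show ?thesis by simp
    qed
    have "i \<le> Suc n" "j - 1 \<le> Suc n" using i j \<open>i < j\<close> by auto
    let ?c = "map (squeeze i) (map (squeeze j) c)"
    have c2: "?c \<in> ops m n" using squeeze_ops[OF cj mi] \<open>i \<le> Suc n\<close> by blast
    have d: "delta (Suc n) l \<in> ops n (Suc n)" for l using delta_ops[of "Suc n" l] by simp
    have "val j c = act C (Suc n) (map ((!) (delta (Suc n) i)) ?c) (s j)"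
      unfolding val_def using delta_squeeze[OF cj mi] \<open>i \<le> Suc n\<close> by metis
    also have "\<dots> = act C n ?c (act C (Suc n) (delta (Suc n) i) (s j))"
      using act_act[OF X d c2] face j by simp
    also have "\<dots> = act C n ?c (act C (Suc n) (delta (Suc n) (j - 1)) (s i))"
      using compat[OF \<open>i < j\<close>] i j by simp
    also have "\<dots> = act C (Suc n) (map ((!) (delta (Suc n) (j - 1))) ?c) (s i)"
      using act_act[OF X d c2] face i by simp
    also have "\<dots> = val i c"
      unfolding val_def swap using delta_squeeze[OF ci mj] \<open>j - 1 \<le> Suc n\<close> by metis
    finally show ?thesis by simp
  qed
  have indep: "val i c = val j c" if "c \<in> ops m ?N" "?miss c i" "?miss c j" for c m i j
  proof (cases i j rule: linorder_cases)
    case less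
    then show ?thesis by (rule val_less[OF that])
  next
    case greater
    then show ?thesis by (rule val_less[OF that(1,3,2), symmetric])
  qed simp
  define f where "f m c = val (SOME i. ?miss c i) c" for m :: nat and c
  have f: "f m' c = val i c" if "c \<in> ops m ?N" "?miss c i" for m m' c i
    unfolding f_def by (rule indep[OF that(1) someI[of "?miss c", OF that(2)] that(2)])
  have "smap (horn ?N k) C f"
    unfolding smap_def
  proof (intro conjI allI ballI)
    fix m c assume "c \<in> cells (horn ?N k) m"
    then obtain i where c: "c \<in> ops m ?N" and i: "?miss c i" by (auto simp: horn_cells)
    then show "f m c \<in> cells C m"
      using squeeze_ops[OF c, of i] face act_cells[OF X] by (simp add: f[OF c i] val_def)
  next
    fix m l a c assume a: "a \<in> ops m l" and "c \<in> cells (horn ?N k) l"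
    then obtain i where c: "c \<in> ops l ?N" and i: "?miss c i" by (auto simp: horn_cells)
    have ci: "map (squeeze i) c \<in> ops l (Suc n)" using squeeze_ops[OF c, of i] i by simp
    have i': "?miss (map ((!) c) a) i" using set_comp_subset[OF c a] i by blast
    have "f m (act (horn ?N k) l a c) = val i (map ((!) c) a)"
      using f[OF ops_comp[OF c a] i'] by (simp add: horn_act)
    also have "\<dots> = act C l a (val i c)"
    proof -
      have "map (squeeze i) (map ((!) c) a) = map ((!) (map (squeeze i) c)) a"
        using a c by (auto simp: ops_def)
      then show ?thesis
        unfolding val_def using act_act[OF X ci a, of "s i"] face i by (metis (no_types))
    qed
    finally show "f m (act (horn ?N k) l a c) = act C l a (f l c)" by (simp add: f[OF c i])
  qed
  then obtain g where g: "smap (Delta ?N) C g" and agree: "agree_on (horn ?N k) g f"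
    using C k unfolding quasicategory_def by blast
  have top: "[0..<Suc ?N] \<in> ops ?N ?N" by (auto simp: ops_def simp del: upt_Suc)
  show ?thesis
  proof (intro bexI[of _ "g ?N [0..<Suc ?N]"] allI impI)
    show "g ?N [0..<Suc ?N] \<in> cells C ?N"
      using smap_cells[OF g, of "[0..<Suc ?N]"] top by (simp add: Delta_cells del: upt_Suc)
    fix i assume i: "i \<le> ?N" "i \<noteq> k"
    have d: "delta ?N i \<in> ops (Suc n) ?N" using delta_ops[of ?N i] by simp
    have "map ((!) [0..<Suc ?N]) (delta ?N i) = delta ?N i"
      using d by (auto simp: ops_def simp del: upt_Suc intro!: map_idI)
    then have "act C ?N (delta ?N i) (g ?N [0..<Suc ?N]) = g (Suc n) (delta ?N i)"
      using smap_act[OF g d, of "[0..<Suc ?N]"] top by (simp add: Delta_cells Delta_act del: upt_Suc)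
    also have "\<dots> = f (Suc n) (delta ?N i)"
      using agree d i delta_misses[of i] unfolding agree_on_def horn_cells by blast
    also have "\<dots> = act C (Suc n) [0..<?N] (s i)"
      using f[OF d, of i] i delta_misses squeeze_delta by (simp add: val_def del: upt_Suc)
    also have "\<dots> = s i" using act_id[OF X] face i by (simp del: upt_Suc)
    finally show "act C ?N (delta ?N i) (g ?N [0..<Suc ?N]) = s i" .
  qed
qed

section \<open>Composition up to homotopy\<close>

lemma small_ops [simp]:
  "[x] \<in> ops 0 n \<longleftrightarrow> x \<le> n"
  "[x, y] \<in> ops (Suc 0) n \<longleftrightarrow> x \<le> y \<and> y \<le> n"
  "[x, y, z] \<in> ops 2 n \<longleftrightarrow> x \<le> y \<and> y \<le> z \<and> z \<le> n"
  by (auto simp: ops_def)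

lemma small_delta:
  "delta 1 0 = [1]" "delta 1 1 = [0]"
  "delta 2 0 = [1, 2]" "delta 2 1 = [0, 2]" "delta 2 2 = [0, 1]"
  "delta 3 0 = [1, 2, 3]" "delta 3 1 = [0, 2, 3]" "delta 3 2 = [0, 1, 3]" "delta 3 3 = [0, 1, 2]"
  by (simp_all add: delta_def upt_rec numeral_eq_Suc)

lemma quasicategory_sset: "quasicategory C \<Longrightarrow> is_sset C"
  by (simp add: quasicategory_def)

lemma edgeD:
  assumes "is_sset C" "edge C x y f"
  shows "x \<in> obj C" "y \<in> obj C" "f \<in> cells C 1"
  using assms act_cells[OF assms(1), of "[0]" 0 1 f] act_cells[OF assms(1), of "[1]" 0 1 f]
  by (auto simp: edge_def)

lemma composite_edges:
  assumes X: "is_sset C" and c: "composite C u v w"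
  obtains x y z where "edge C x y u" "edge C y z v" "edge C x z w"
proof -
  obtain s where s: "s \<in> cells C 2"
    and e: "act C 2 [0, 1] s = u" "act C 2 [1, 2] s = v" "act C 2 [0, 2] s = w"
    using c unfolding composite_def by blast
  have "edge C (act C 2 [i] s) (act C 2 [j] s) (act C 2 [i, j] s)" if "i \<le> j" "j \<le> 2" for i j
    using that s act_act[OF X, of "[i, j]" 1 2 "[0]" 0 s] act_act[OF X, of "[i, j]" 1 2 "[1]" 0 s]
      act_cells[OF X, of "[i, j]" 1 2 s]
    by (simp add: edge_def)
  from this[of 0 1] this[of 1 2] this[of 0 2] show ?thesis using e that by simp
qed

lemma composite_exists:
  assumes C: "quasicategory C" and u: "edge C x y u" and v: "edge C y z v"
  obtains w where "composite C u v w"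
proof -
  \<comment> \<open>the face opposite to vertex 0 is the edge 12, the face opposite to vertex 2 is the edge 01\<close>
  define s where "s i = (if i = 0 then v else u)" for i :: nat
  have "\<exists>t\<in>cells C (Suc (Suc 0)). \<forall>i\<le>Suc (Suc 0). i \<noteq> 1 \<longrightarrow>
      act C (Suc (Suc 0)) (delta (Suc (Suc 0)) i) t = s i"
  proof (rule inner_horn_filler[OF C])
    fix i j :: nat assume "i < j" "j \<le> Suc (Suc 0)" "i \<noteq> 1" "j \<noteq> 1"
    then have "i = 0 \<and> j = 2" by auto
    then show "act C (Suc 0) (delta (Suc 0) i) (s j) = act C (Suc 0) (delta (Suc 0) (j - 1)) (s i)"
      using u v small_delta(1,2) by (simp add: s_def edge_def)
  qed (use u v in \<open>auto simp: s_def edge_def\<close>)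
  then obtain t where t: "t \<in> cells C 2" "\<And>i. i \<le> 2 \<Longrightarrow> i \<noteq> 1 \<Longrightarrow> act C 2 (delta 2 i) t = s i"
    by (auto simp: numeral_2_eq_2)
  have "composite C u v (act C 2 [0, 2] t)"
    unfolding composite_def using t(1) t(2)[of 0] t(2)[of 2] small_delta(3,5)
    by (auto simp: s_def)
  then show ?thesis by (rule that)
qed

text \<open>
  Both implications complete a 3-simplex with edges \<open>u\<close>, \<open>v\<close>, \<open>w\<close> along its spine. The faces 012 and
  123 are given; from left to right the face 023 is given as well and the horn at vertex 2 yields 013,
  from right to left the roles of 023 and 013 are exchanged and the horn is at vertex 1.
\<close>

lemma composite_assoc:
  assumes C: "quasicategory C" and uv: "composite C u v p" and vw: "composite C v w q"
  shows "composite C p w r \<longleftrightarrow> composite C u q r"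
proof -
  have X: "is_sset C" using C by (rule quasicategory_sset)
  obtain t0 where t0: "t0 \<in> cells C 2"
    "act C 2 [0, 1] t0 = v" "act C 2 [1, 2] t0 = w" "act C 2 [0, 2] t0 = q"
    using vw unfolding composite_def by blast
  obtain t3 where t3: "t3 \<in> cells C 2"
    "act C 2 [0, 1] t3 = u" "act C 2 [1, 2] t3 = v" "act C 2 [0, 2] t3 = p"
    using uv unfolding composite_def by blast
  have face: "act C 2 [i, j] (act C 3 [a, b, c] t) = act C 3 [[a, b, c] ! i, [a, b, c] ! j] t"
    if "t \<in> cells C 3" "i \<le> j" "j \<le> 2" "a \<le> b" "b \<le> c" "c \<le> 3" for i j a b c t
    using that act_act[OF X, of "[a, b, c]" 2 3 "[i, j]" 1 t] by simp
  have tri: "act C 3 [a, b, c] t \<in> cells C 2"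
    if "t \<in> cells C 3" "a \<le> b" "b \<le> c" "c \<le> 3" for a b c t
    using that act_cells[OF X, of "[a, b, c]" 2 3 t] by simp
  have fill: "\<exists>t\<in>cells C 3. \<forall>i\<le>3. i \<noteq> k \<longrightarrow> act C 3 (delta 3 i) t = s i"
    if k: "k = 1 \<or> k = 2" and "\<And>i. i \<le> 3 \<Longrightarrow> i \<noteq> k \<Longrightarrow> s i \<in> cells C 2"
      and "\<And>i j. i < j \<Longrightarrow> j \<le> 3 \<Longrightarrow> i \<noteq> k \<Longrightarrow> j \<noteq> k \<Longrightarrow>
        act C 2 (delta 2 i) (s j) = act C 2 (delta 2 (j - 1)) (s i)" for k s
    using inner_horn_filler[OF C, of k 1 s] that by (auto simp: numeral_eq_Suc)
  show ?thesis
  proof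
    assume "composite C p w r"
    then obtain t1 where t1: "t1 \<in> cells C 2"
      "act C 2 [0, 1] t1 = p" "act C 2 [1, 2] t1 = w" "act C 2 [0, 2] t1 = r"
      unfolding composite_def by blast
    define s where "s i = (if i = 0 then t0 else if i = 1 then t1 else t3)" for i :: nat
    have "\<exists>t\<in>cells C 3. \<forall>i\<le>3. i \<noteq> 2 \<longrightarrow> act C 3 (delta 3 i) t = s i"
    proof (rule fill)
      show "act C 2 (delta 2 i) (s j) = act C 2 (delta 2 (j - 1)) (s i)"
        if "i < j" "j \<le> 3" "i \<noteq> 2" "j \<noteq> 2" for i j
      proof -
        have "(i, j) \<in> {(0, 1), (0, 3), (1, 3)}" using that by auto
        then show ?thesis using small_delta t0 t1 t3 by (auto simp: s_def)
      qed
    qed (use t0 t1 t3 in \<open>auto simp: s_def\<close>)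
    then obtain t where t: "t \<in> cells C 3" "\<And>i. i \<le> 3 \<Longrightarrow> i \<noteq> 2 \<Longrightarrow> act C 3 (delta 3 i) t = s i"
      by blast
    have f: "act C 3 [1, 2, 3] t = t0" "act C 3 [0, 2, 3] t = t1" "act C 3 [0, 1, 2] t = t3"
      using t(2)[of 0] t(2)[of 1] t(2)[of 3] small_delta by (auto simp: s_def)
    show "composite C u q r"
      unfolding composite_def
      using tri[OF t(1), of 0 1 3] face[OF t(1), of 0 1 0 1 3] face[OF t(1), of 1 2 0 1 3]
        face[OF t(1), of 0 2 0 1 3] face[OF t(1), of 0 1 0 1 2] face[OF t(1), of 0 2 1 2 3]
        face[OF t(1), of 0 2 0 2 3] f t0 t1 t3
      by (intro bexI[of _ "act C 3 [0, 1, 3] t"]) auto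
  next
    assume "composite C u q r"
    then obtain t2 where t2: "t2 \<in> cells C 2"
      "act C 2 [0, 1] t2 = u" "act C 2 [1, 2] t2 = q" "act C 2 [0, 2] t2 = r"
      unfolding composite_def by blast
    define s where "s i = (if i = 0 then t0 else if i = 2 then t2 else t3)" for i :: nat
    have "\<exists>t\<in>cells C 3. \<forall>i\<le>3. i \<noteq> 1 \<longrightarrow> act C 3 (delta 3 i) t = s i"
    proof (rule fill)
      show "act C 2 (delta 2 i) (s j) = act C 2 (delta 2 (j - 1)) (s i)"
        if "i < j" "j \<le> 3" "i \<noteq> 1" "j \<noteq> 1" for i j
      proof -
        have "(i, j) \<in> {(0, 2), (0, 3), (2, 3)}" using that by auto
        then show ?thesis using small_delta t0 t2 t3 by (auto simp: s_def)
      qed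
    qed (use t0 t2 t3 in \<open>auto simp: s_def\<close>)
    then obtain t where t: "t \<in> cells C 3" "\<And>i. i \<le> 3 \<Longrightarrow> i \<noteq> 1 \<Longrightarrow> act C 3 (delta 3 i) t = s i"
      by blast
    have f: "act C 3 [1, 2, 3] t = t0" "act C 3 [0, 1, 3] t = t2" "act C 3 [0, 1, 2] t = t3"
      using t(2)[of 0] t(2)[of 2] t(2)[of 3] small_delta by (auto simp: s_def)
    show "composite C p w r"
      unfolding composite_def
      using tri[OF t(1), of 0 2 3] face[OF t(1), of 0 1 0 2 3] face[OF t(1), of 1 2 0 2 3]
        face[OF t(1), of 0 2 0 2 3] face[OF t(1), of 0 2 0 1 2] face[OF t(1), of 1 2 1 2 3]
        face[OF t(1), of 0 2 0 1 3] f t0 t2 t3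
      by (intro bexI[of _ "act C 3 [0, 2, 3] t"]) auto
  qed
qed

lemma composite_ident:
  assumes X: "is_sset C" and u: "edge C x y u"
  shows "composite C (ident C x) u u" "composite C u (ident C y) u"
proof -
  have u1: "u \<in> cells C 1" and x: "act C 1 [0] u = x" and y: "act C 1 [1] u = y"
    using u by (auto simp: edge_def)
  have uu: "act C 1 [0, 1] u = u" using act_id[OF X u1] by simp
  have face: "act C 2 [i, j] (act C 1 [a, b, c] u) = act C 1 [[a, b, c] ! i, [a, b, c] ! j] u"
    if "i \<le> j" "j \<le> 2" "a \<le> b" "b \<le> c" "c \<le> 1" for i j a b c
    using that u1 act_act[OF X, of "[a, b, c]" 2 1 "[i, j]" 1 u] by simp
  have tri: "act C 1 [a, b, c] u \<in> cells C 2" if "a \<le> b" "b \<le> c" "c \<le> 1" for a b c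
    using that u1 act_cells[OF X, of "[a, b, c]" 2 1 u] by simp
  have id: "act C 1 [i, i] u = ident C (act C 1 [i] u)" if "i \<le> 1" for i
    unfolding ident_def using that u1 act_act[OF X, of "[i]" 0 1 "[0, 0]" 1 u] by simp
  show "composite C (ident C x) u u"
    unfolding composite_def using tri[of 0 0 1] face[of 0 1 0 0 1] face[of 1 2 0 0 1]
      face[of 0 2 0 0 1] uu id[of 0] x by (intro bexI[of _ "act C 1 [0, 0, 1] u"]) auto
  show "composite C u (ident C y) u"
    unfolding composite_def using tri[of 0 1 1] face[of 0 1 0 1 1] face[of 1 2 0 1 1]
      face[of 0 2 0 1 1] uu id[of 1] y by (intro bexI[of _ "act C 1 [0, 1, 1] u"]) auto
qed

lemma edge_ident:
  assumes X: "is_sset C" and x: "x \<in> obj C"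
  shows "edge C x x (ident C x)"
  unfolding edge_def ident_def
  using x act_cells[OF X, of "[0, 0]" 1 0 x] act_act[OF X, of "[0, 0]" 1 0 "[0]" 0 x]
    act_act[OF X, of "[0, 0]" 1 0 "[1]" 0 x] act_id[OF X x] by simp

lemma composite_endpoints:
  assumes "is_sset C" "composite C u v w" "edge C x y u" "edge C y' z v"
  shows "y = y'" "edge C x z w"
  using composite_edges[OF assms(1,2)] assms(3,4) by (metis edge_def)+

lemma smap_edge: "smap C D F \<Longrightarrow> edge C x y u \<Longrightarrow> edge D (F 0 x) (F 0 y) (F 1 u)"
  using smap_act[of C D F "[0]" 0 1 u] smap_act[of C D F "[1]" 0 1 u] smap_cells[of C D F u 1]
  by (auto simp: edge_def)

lemma smap_ident: "smap C D F \<Longrightarrow> x \<in> obj C \<Longrightarrow> F 1 (ident C x) = ident D (F 0 x)"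
  using smap_act[of C D F "[0, 0]" 1 0 x] by (simp add: ident_def)

lemma smap_composite:
  assumes F: "smap C D F" and c: "composite C u v w"
  shows "composite D (F 1 u) (F 1 v) (F 1 w)"
proof -
  obtain s where s: "s \<in> cells C 2"
    and e: "act C 2 [0, 1] s = u" "act C 2 [1, 2] s = v" "act C 2 [0, 2] s = w"
    using c unfolding composite_def by blast
  show ?thesis
    unfolding composite_def e[symmetric]
    using s smap_cells[OF F s] smap_act[OF F, of "[0, 1]" 1 2 s] smap_act[OF F, of "[1, 2]" 1 2 s]
      smap_act[OF F, of "[0, 2]" 1 2 s] by (intro bexI[of _ "F 2 s"]) auto
qed

lemma smap_comp: "smap C D F \<Longrightarrow> smap D E H \<Longrightarrow> smap C E (H \<bullet> F)"
  unfolding smap_def fcomp_def by simp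

lemma smap_fid: "smap C C fid"
  unfolding smap_def fid_def by simp


section \<open>Evaluating natural transformations at an object\<close>

text \<open>
  A transformation is a map from the product of C with the 1-simplex; its component at x is the
  image of the edge that stays at x while the other coordinate moves from 0 to 1.
\<close>

definition component :: "'a sset \<Rightarrow> ('a, 'b) fun_cell \<Rightarrow> 'a \<Rightarrow> 'b" where
  "component C u x = u 1 (ident C x, [0, 1])"

lemma prod_Delta_cells: "cells (prod_sset X (Delta n)) m = cells X m \<times> ops m n"
  by (simp add: prod_sset_def Delta_cells)

lemma prod_Delta_act: "act (prod_sset X (Delta n)) m a (x, c) = (act X m a x, map ((!) c) a)"
  by (simp add: prod_sset_def Delta_act)

lemma Fun_cells: "F \<in> cells (Fun X Y) n \<Longrightarrow> smap (prod_sset X (Delta n)) Y F"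
  by (simp add: Fun_def)

lemma Fun_act:
  "x \<in> cells X k \<Longrightarrow> c \<in> ops k (length a - 1) \<Longrightarrow>
    act (Fun X Y) n a F k (x, c) = F k (x, map ((!) a) c)"
  by (simp add: Fun_def restr_def prod_Delta_cells)

lemma Fun_act_cells:
  assumes X: "is_sset X" and a: "a \<in> ops m n" and F: "F \<in> cells (Fun X Y) n"
  shows "act (Fun X Y) n a F \<in> cells (Fun X Y) m"
proof -
  have F': "smap (prod_sset X (Delta n)) Y F" using F by (rule Fun_cells)
  have l: "length a - Suc 0 = m" using a by (simp add: ops_def)
  have "smap (prod_sset X (Delta m)) Y (act (Fun X Y) n a F)"
    unfolding smap_def
  proof (intro conjI allI ballI)
    fix k p assume "p \<in> cells (prod_sset X (Delta m)) k"
    then obtain x c where p: "p = (x, c)" "x \<in> cells X k" "c \<in> ops k m"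
      by (auto simp: prod_Delta_cells)
    then show "act (Fun X Y) n a F k p \<in> cells Y k"
      using smap_cells[OF F', of "(x, map ((!) a) c)" k] ops_comp[OF a, of c k]
      by (simp add: Fun_act l prod_Delta_cells)
  next
    fix j k b p assume b: "b \<in> ops j k" and "p \<in> cells (prod_sset X (Delta m)) k"
    then obtain x c where p: "p = (x, c)" "x \<in> cells X k" "c \<in> ops k m"
      by (auto simp: prod_Delta_cells)
    have "map ((!) (map ((!) a) c)) b = map ((!) a) (map ((!) c) b)"
      using b p(3) by (auto simp: ops_def)
    then show "act (Fun X Y) n a F j (act (prod_sset X (Delta m)) k b p) =
        act Y k b (act (Fun X Y) n a F k p)"
      using p b smap_act[OF F' b, of "(x, map ((!) a) c)"] ops_comp[OF a p(3)] ops_comp[OF p(3) b]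
        act_cells[OF X b p(2)]
      by (simp add: Fun_act l prod_Delta_cells prod_Delta_act del: map_map)
  qed
  then show ?thesis by (simp add: Fun_def restr_def l cong: if_cong)
qed

lemma ident_cells: "is_sset C \<Longrightarrow> x \<in> obj C \<Longrightarrow> ident C x \<in> cells C 1"
  using edge_ident[of C x] by (simp add: edge_def)

lemma component_edge:
  assumes C: "is_sset C" and x: "x \<in> obj C" and u: "edge (Fun C D) F H u"
  shows "edge D (F 0 (x, [0])) (H 0 (x, [0])) (component C u x)"
proof -
  have u1: "smap (prod_sset C (Delta 1)) D u" and F: "F = act (Fun C D) 1 [0] u"
    and H: "H = act (Fun C D) 1 [1] u"
    using u Fun_cells by (auto simp: edge_def)
  have e: "act C 1 [0] (ident C x) = x" "act C 1 [1] (ident C x) = x"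
    using edge_ident[OF C x] by (auto simp: edge_def)
  show ?thesis
    unfolding edge_def component_def F H
    using smap_cells[OF u1, of "(ident C x, [0, 1])" 1] smap_act[OF u1, of "[0]" 0 1 "(ident C x, [0, 1])"]
      smap_act[OF u1, of "[1]" 0 1 "(ident C x, [0, 1])"] ident_cells[OF C x] x e
    by (simp add: Fun_act prod_Delta_cells prod_Delta_act)
qed

lemma component_nat_trans:
  assumes C: "is_sset C" and x: "x \<in> obj C" and u: "nat_trans C D f g u"
  shows "edge D (f 0 x) (g 0 x) (component C u x)"
proof -
  have "fvertex C h 0 (x, [0]) = h 0 x" for h :: "nat \<Rightarrow> 'a \<Rightarrow> 'b"
    using x by (simp add: fvertex_def restr_def prod_Delta_cells)
  then show ?thesis using component_edge[OF C x] u unfolding nat_trans_def by metis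
qed

text \<open>
  A 2-simplex of \<open>Fun C D\<close> is a map on the product of C with the 2-simplex. Restricting it to the
  constant simplex at x in the first coordinate gives a 2-simplex of D. Thus evaluation at x turns
  homotopy relations between transformations into relations between their components.
\<close>

lemma component_composite:
  assumes C: "is_sset C" and x: "x \<in> obj C" and c: "composite (Fun C D) u v w"
  shows "composite D (component C u x) (component C v x) (component C w x)"
proof -
  obtain s where s: "s \<in> cells (Fun C D) 2" and e: "act (Fun C D) 2 [0, 1] s = u"
    "act (Fun C D) 2 [1, 2] s = v" "act (Fun C D) 2 [0, 2] s = w"
    using c unfolding composite_def by blast
  have S: "smap (prod_sset C (Delta 2)) D s" using s by (rule Fun_cells)
  \<comment> \<open>the constant 2-simplex at x\<close>
  let ?t = "act C 0 [0, 0, 0] x"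
  have t: "?t \<in> cells C 2" using act_cells[OF C, of "[0, 0, 0]" 2 0 x] x by simp
  have face: "act D 2 [i, j] (s 2 (?t, [0, 1, 2])) = component C (act (Fun C D) 2 [i, j] s) x"
    if "i \<le> j" "j \<le> 2" for i j
  proof -
    have c: "[0, 1, 2] ! i = i" "[0, 1, 2] ! j = j" "[0, 0, 0] ! i = (0 :: nat)" "[0, 0, 0] ! j = (0 :: nat)"
      using that by (auto simp: numeral_2_eq_2 le_Suc_eq)
    have "act C 2 [i, j] ?t = ident C x"
      unfolding ident_def using act_act[OF C, of "[0, 0, 0]" 2 0 "[i, j]" 1 x] x that c by simp
    then show ?thesis
      unfolding component_def
      using that c smap_act[OF S, of "[i, j]" 1 2 "(?t, [0, 1, 2])"] t ident_cells[OF C x]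
      by (simp add: Fun_act prod_Delta_cells prod_Delta_act)
  qed
  have "s 2 (?t, [0, 1, 2]) \<in> cells D 2"
    using smap_cells[OF S, of "(?t, [0, 1, 2])" 2] t by (simp add: prod_Delta_cells)
  then show ?thesis
    unfolding composite_def using face[of 0 1] face[of 1 2] face[of 0 2] e by auto
qed

lemma component_ident:
  assumes C: "is_sset C" and x: "x \<in> obj C" and u: "u \<in> cells (Fun C D) 1" and i: "i \<le> 1"
  shows "component C (ident (Fun C D) (act (Fun C D) 1 [i] u)) x =
    ident D (act D 1 [i] (component C u x))"
proof -
  have U: "smap (prod_sset C (Delta 1)) D u" using u by (rule Fun_cells)
  have e: "act C 1 [i] (ident C x) = x"
    using i edge_ident[OF C x] by (auto simp: edge_def le_Suc_eq)
  have b: "[0, 1] ! i = i" using i by (auto simp: le_Suc_eq)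
  have "act D 1 [i] (component C u x) = u 0 (x, [i])"
    unfolding component_def
    using i b e smap_act[OF U, of "[i]" 0 1 "(ident C x, [0, 1])"] ident_cells[OF C x]
    by (simp add: prod_Delta_cells prod_Delta_act)
  then have "ident D (act D 1 [i] (component C u x)) = u 1 (ident C x, [i, i])"
    using i x smap_act[OF U, of "[0, 0]" 1 0 "(x, [i])"]
    by (simp add: ident_def prod_Delta_cells prod_Delta_act)
  moreover have "component C (ident (Fun C D) (act (Fun C D) 1 [i] u)) x = u 1 (ident C x, [i, i])"
    using ident_cells[OF C x] by (simp add: component_def ident_def[of "Fun C D"] Fun_act)
  ultimately show ?thesis by simp
qed

lemma component_ident_vertex:
  assumes C: "is_sset C" and x: "x \<in> obj C" and f: "smap C D f"
  shows "component C (ident (Fun C D) (fvertex C f)) x = ident D (f 0 x)"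
  using ident_cells[OF C x] smap_ident[OF f x]
  by (simp add: component_def ident_def[of "Fun C D"] Fun_act fvertex_def restr_def prod_Delta_cells)

lemma component_postw:
  "is_sset C \<Longrightarrow> x \<in> obj C \<Longrightarrow> component C (postw C g u) x = g 1 (component C u x)"
  using ident_cells[of C x] by (simp add: component_def postw_def restr_def prod_Delta_cells)

lemma component_prew:
  "is_sset C \<Longrightarrow> smap C D f \<Longrightarrow> x \<in> obj C \<Longrightarrow> component C (prew C f u) x = component D u (f 0 x)"
  using ident_cells[of C x] smap_ident[of C D f x] by (simp add: component_def prew_def restr_def prod_Delta_cells)

lemma component_equivalence:
  assumes C: "is_sset C" and x: "x \<in> obj C" and u: "equivalence (Fun C D) u"
  shows "equivalence D (component C u x)"
proof -
  obtain v where v: "composite (Fun C D) u v (ident (Fun C D) (act (Fun C D) 1 [0] u))"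
    "composite (Fun C D) v u (ident (Fun C D) (act (Fun C D) 1 [1] u))"
    using u unfolding equivalence_def inverse_edges_def by blast
  have "u \<in> cells (Fun C D) 1"
    using v(1) Fun_act_cells[OF C, of "[0, 1]" 1 2] unfolding composite_def by auto
  from component_ident[OF C x this, of 0] component_ident[OF C x this, of 1] show ?thesis
    using component_composite[OF C x v(1)] component_composite[OF C x v(2)]
    unfolding equivalence_def inverse_edges_def by auto
qed

text \<open>
  The transformation maps the square with sides \<open>e\<close> and the 1-simplex to D. Its two triangles share
  the diagonal \<open>d\<close>.
\<close>

lemma component_naturality:
  assumes C: "is_sset C" and f: "smap C D f" and g: "smap C D g"
    and u: "nat_trans C D f g u" and e: "edge C x y e"
  obtains d where "composite D (component C u x) (g 1 e) d" "composite D (f 1 e) (component C u y) d"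
proof -
  have U: "smap (prod_sset C (Delta 1)) D u"
    using u Fun_cells by (auto simp: edge_def nat_trans_def)
  have e1: "e \<in> cells C 1" "act C 1 [0] e = x" "act C 1 [1] e = y" using e by (auto simp: edge_def)
  have "fvertex C f = act (Fun C D) 1 [0] u" "fvertex C g = act (Fun C D) 1 [1] u"
    using u by (auto simp: edge_def nat_trans_def)
  from this[THEN fun_cong, THEN fun_cong, of 1 "(e, [0, 0])"]
  have ends: "f 1 e = u 1 (e, [0, 0])" "g 1 e = u 1 (e, [1, 1])"
    using e1 by (simp_all add: fvertex_def restr_def Fun_act prod_Delta_cells)
  have face: "act D 2 [i, j] (u 2 (act C 1 c e, b)) =
      u 1 (act C 1 [c ! i, c ! j] e, [b ! i, b ! j])"
    and tri: "u 2 (act C 1 c e, b) \<in> cells D 2"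
    if "i \<le> j" "j \<le> 2" "c \<in> ops 2 1" "b \<in> ops 2 1" for i j b c
    using that e1 smap_act[OF U, of "[i, j]" 1 2 "(act C 1 c e, b)"]
      smap_cells[OF U, of "(act C 1 c e, b)" 2] act_cells[OF C that(3) e1(1)]
      act_act[OF C that(3), of "[i, j]" 1 e]
    by (simp_all add: prod_Delta_cells prod_Delta_act)
  have id: "act C 1 [i, i] e = ident C (act C 1 [i] e)" if "i \<le> 1" for i
    unfolding ident_def using that e1 act_act[OF C, of "[i]" 0 1 "[0, 0]" 1 e] by simp
  have ee: "act C 1 [0, 1] e = e" using act_id[OF C e1(1)] by simp
  show ?thesis
  proof (rule that)
    show "composite D (component C u x) (g 1 e) (u 1 (e, [0, 1]))"
      unfolding composite_def component_def ends
      using tri[of 0 1 "[0, 0, 1]" "[0, 1, 1]"] face[of 0 1 "[0, 0, 1]" "[0, 1, 1]"]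
        face[of 1 2 "[0, 0, 1]" "[0, 1, 1]"] face[of 0 2 "[0, 0, 1]" "[0, 1, 1]"] id[of 0] e1 ee
      by (intro bexI[of _ "u 2 (act C 1 [0, 0, 1] e, [0, 1, 1])"]) auto
    show "composite D (f 1 e) (component C u y) (u 1 (e, [0, 1]))"
      unfolding composite_def component_def ends
      using tri[of 0 1 "[0, 1, 1]" "[0, 0, 1]"] face[of 0 1 "[0, 1, 1]" "[0, 0, 1]"]
        face[of 1 2 "[0, 1, 1]" "[0, 0, 1]"] face[of 0 2 "[0, 1, 1]" "[0, 0, 1]"] id[of 1] e1 ee
      by (intro bexI[of _ "u 2 (act C 1 [0, 1, 1] e, [0, 0, 1])"]) auto
  qed
qed


section \<open>Universal arrows\<close>

text \<open>
  The flag b selects a direction: for \<open>True\<close> arrows are edges and adjoints are left adjoints, for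
  \<open>False\<close> all arrows are reversed, so that units and counits, and left and right adjoints, change
  places. A statement for arbitrary b contains its dual.
\<close>

definition arr :: "bool \<Rightarrow> 'a sset \<Rightarrow> 'a \<Rightarrow> 'a \<Rightarrow> 'a \<Rightarrow> bool" where
  "arr b C x y f = (if b then edge C x y f else edge C y x f)"

definition cmp :: "bool \<Rightarrow> 'a sset \<Rightarrow> 'a \<Rightarrow> 'a \<Rightarrow> 'a \<Rightarrow> bool" where
  "cmp b C u v w = (if b then composite C u v w else composite C v u w)"

definition adj :: "bool \<Rightarrow> 'a sset \<Rightarrow> 'b sset \<Rightarrow> (nat \<Rightarrow> 'b \<Rightarrow> 'a) \<Rightarrow> (nat \<Rightarrow> 'a \<Rightarrow> 'b) \<Rightarrow> bool" where
  "adj b C D l f = (if b then adjoint_pair D C l f else adjoint_pair C D f l)"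

text \<open>
  Homotopy of parallel edges, expressed by composition with an identity; for \<open>b = True\<close> it is
  \<open>homotopic\<close> with its identity edge left to be found. Requiring \<open>z\<close> to be an object makes
  \<open>ident C z\<close> an edge from z to z, hence z the target of \<open>w\<close>.
\<close>

definition hom_eq :: "bool \<Rightarrow> 'a sset \<Rightarrow> 'a \<Rightarrow> 'a \<Rightarrow> bool" where
  "hom_eq b C w w' \<longleftrightarrow> (\<exists>z\<in>obj C. cmp b C w (ident C z) w')"

text \<open>
  The object y, with an arrow \<open>u\<close> from x to \<open>f y\<close> that is initial in the homotopy category among
  arrows from x to values of f. For \<open>b = True\<close> this says that y is the value at x of a left adjoint
  of f, wherever that adjoint is defined; for \<open>b = False\<close>, of a right adjoint.
\<close>

definition universal :: "bool \<Rightarrow> 'a sset \<Rightarrow> 'b sset \<Rightarrow> (nat \<Rightarrow> 'a \<Rightarrow> 'b) \<Rightarrow> 'b \<Rightarrow> 'a \<Rightarrow> bool" where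
  "universal b C D f x y \<longleftrightarrow> y \<in> obj C \<and> (\<exists>u. arr b D x (f 0 y) u \<and>
     (\<forall>z v. z \<in> obj C \<and> arr b D x (f 0 z) v \<longrightarrow> (\<exists>w. arr b C y z w \<and> cmp b D u (f 1 w) v)) \<and>
     (\<forall>z v w w'. arr b C y z w \<and> arr b C y z w' \<and> cmp b D u (f 1 w) v \<and> cmp b D u (f 1 w') v
        \<longrightarrow> hom_eq b C w w'))"

context
  fixes b :: bool and C :: "'a sset"
  assumes C: "quasicategory C"
begin

lemma arr_obj: "arr b C x y u \<Longrightarrow> x \<in> obj C" "arr b C x y u \<Longrightarrow> y \<in> obj C"
  using edgeD[OF quasicategory_sset[OF C]] by (auto simp: arr_def split: if_splits)

lemma cmp_arr: "cmp b C u v w \<Longrightarrow> arr b C x y u \<Longrightarrow> arr b C y' z v \<Longrightarrow> arr b C x z w"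
  using composite_endpoints[OF quasicategory_sset[OF C]]
  by (auto simp: arr_def cmp_def split: if_splits)

lemma cmp_exists:
  assumes "arr b C x y u" "arr b C y z v"
  obtains w where "cmp b C u v w" "arr b C x z w"
proof -
  obtain w where "cmp b C u v w"
    using assms composite_exists[OF C] unfolding arr_def cmp_def by (cases b) (simp, blast)+
  then show ?thesis using cmp_arr assms that by blast
qed

text \<open>
  Reversing arrows exchanges the two bracketings, so associativity is its own dual.
\<close>

lemma cmp_assoc:
  "cmp b C u v p \<Longrightarrow> cmp b C v w q \<Longrightarrow> cmp b C p w r \<longleftrightarrow> cmp b C u q r"
  using composite_assoc[OF C, of u v p w q r] composite_assoc[OF C, of w v q u p r]
  by (simp add: cmp_def split: if_splits)

lemma cmp_ident:
  "arr b C x y u \<Longrightarrow> cmp b C (ident C x) u u" "arr b C x y u \<Longrightarrow> cmp b C u (ident C y) u"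
  using composite_ident[OF quasicategory_sset[OF C]] by (auto simp: arr_def cmp_def)

lemma arr_ident: "x \<in> obj C \<Longrightarrow> arr b C x x (ident C x)"
  using edge_ident[OF quasicategory_sset[OF C]] by (simp add: arr_def)

lemma cmp_has_arrs:
  assumes "cmp b C u v w"
  obtains x y z where "arr b C x y u" "arr b C y z v" "arr b C x z w"
  using assms composite_edges[OF quasicategory_sset[OF C]]
  by (cases b) (simp_all add: arr_def cmp_def, blast+)

lemma cmp_match:
  "cmp b C u v w \<Longrightarrow> arr b C x y u \<Longrightarrow> arr b C y' z v \<Longrightarrow> y = y'"
  using composite_endpoints[OF quasicategory_sset[OF C]]
  by (metis arr_def cmp_def)

text \<open>
  Composites are unique up to homotopy: apply associativity to \<open>u\<close>, \<open>v\<close> and the identity of the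
  target of \<open>v\<close>.
\<close>

lemma hom_eqI:
  assumes "cmp b C u v w" "cmp b C u v w'"
  shows "hom_eq b C w w'"
proof -
  obtain x y z where a: "arr b C x y u" "arr b C y z v" "arr b C x z w"
    using assms(1) by (rule cmp_has_arrs)
  have "cmp b C w (ident C z) w'"
    using cmp_assoc[OF assms(1) cmp_ident(2)[OF a(2)]] assms(2) by blast
  then show ?thesis using arr_obj(2)[OF a(2)] unfolding hom_eq_def by blast
qed

lemma cmp_cong_result:
  assumes "hom_eq b C w w'" "cmp b C u v w"
  shows "cmp b C u v w'"
proof -
  obtain z where z: "z \<in> obj C" "cmp b C w (ident C z) w'"
    using assms(1) unfolding hom_eq_def by blast
  obtain p q r where a: "arr b C p q u" "arr b C q r v" "arr b C p r w"
    using assms(2) by (rule cmp_has_arrs)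
  have "r = z" using cmp_match[OF z(2) a(3) arr_ident[OF z(1)]] .
  then show ?thesis
    using cmp_assoc[OF assms(2) cmp_ident(2)[OF a(2)]] z(2) by blast
qed

end

lemma smap_arr: "smap C D F \<Longrightarrow> arr b C x y u \<Longrightarrow> arr b D (F 0 x) (F 0 y) (F 1 u)"
  using smap_edge[of C D F] by (simp add: arr_def)

lemma smap_cmp: "smap C D F \<Longrightarrow> cmp b C u v w \<Longrightarrow> cmp b D (F 1 u) (F 1 v) (F 1 w)"
  using smap_composite[of C D F] by (simp add: cmp_def split: if_splits)

text \<open>
  Equivalence of objects is independent of direction: reversing arrows exchanges an edge with its
  homotopy inverse.
\<close>

lemma equivalent_iff:
  assumes C: "quasicategory C"
  shows "equivalent C y y' \<longleftrightarrow> (\<exists>w w'. arr b C y y' w \<and> arr b C y' y w' \<and>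
    cmp b C w w' (ident C y) \<and> cmp b C w' w (ident C y'))" (is "_ \<longleftrightarrow> ?R")
proof
  assume "equivalent C y y'"
  then obtain f g where f: "edge C y y' f" and fg: "composite C f g (ident C y)"
    "composite C g f (ident C y')"
    unfolding equivalent_def equivalence_def inverse_edges_def edge_def by auto
  have X: "is_sset C" using C by (rule quasicategory_sset)
  have "edge C y' y g"
  proof -
    have "edge C y y (ident C y)" using edge_ident[OF X] edgeD[OF X f] by blast
    moreover obtain p q r where "edge C p q f" "edge C q r g" "edge C p r (ident C y)"
      using composite_edges[OF X fg(1)] by metis
    ultimately show ?thesis using f by (metis edge_def)
  qed
  then show ?R
    using f fg by (cases b) (auto simp: arr_def cmp_def)
next
  assume ?R
  then obtain w w' where w: "arr b C y y' w" "arr b C y' y w'"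
    "cmp b C w w' (ident C y)" "cmp b C w' w (ident C y')" by blast
  have "edge C y y' (if b then w else w') \<and> equivalence C (if b then w else w')"
    using w by (auto simp: arr_def cmp_def equivalence_def inverse_edges_def edge_def)
  then show "equivalent C y y'" unfolding equivalent_def by blast
qed

lemma equivalent_refl:
  assumes C: "quasicategory C" and x: "x \<in> obj C"
  shows "equivalent C x x"
  using equivalent_iff[OF C, of x x True] arr_ident[OF C x, of True]
    cmp_ident(1)[OF C arr_ident[OF C x, of True]] by blast

lemma equivalent_sym: "quasicategory C \<Longrightarrow> equivalent C x y \<Longrightarrow> equivalent C y x"
  using equivalent_iff[of C _ _ True] by blast

lemma equivalent_obj: "quasicategory C \<Longrightarrow> equivalent C x y \<Longrightarrow> y \<in> obj C"
  unfolding equivalent_def by (metis edgeD(2) quasicategory_sset)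

lemma smap_equivalent:
  assumes "quasicategory C" "quasicategory D" "smap C D F" "equivalent C x y"
  shows "equivalent D (F 0 x) (F 0 y)"
proof -
  obtain f g where f: "arr True C x y f" "arr True C y x g"
    and fg: "cmp True C f g (ident C x)" "cmp True C g f (ident C y)"
    using assms(4) equivalent_iff[OF assms(1), of x y True] by blast
  have "x \<in> obj C" "y \<in> obj C" using arr_obj[OF assms(1) f(1)] .
  then show ?thesis
    unfolding equivalent_iff[OF assms(2), of _ _ True]
    using smap_arr[OF assms(3) f(1)] smap_arr[OF assms(3) f(2)] smap_cmp[OF assms(3) fg(1)]
      smap_cmp[OF assms(3) fg(2)] smap_ident[OF assms(3)] by metis
qed

lemma universalI:
  assumes "y \<in> obj C" "arr b D x (f 0 y) u"
    and "\<And>z v. z \<in> obj C \<Longrightarrow> arr b D x (f 0 z) v \<Longrightarrow> \<exists>w. arr b C y z w \<and> cmp b D u (f 1 w) v"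
    and "\<And>z v w w'. arr b C y z w \<Longrightarrow> arr b C y z w' \<Longrightarrow> cmp b D u (f 1 w) v \<Longrightarrow>
      cmp b D u (f 1 w') v \<Longrightarrow> hom_eq b C w w'"
  shows "universal b C D f x y"
  using assms unfolding universal_def by blast

lemma universalD:
  assumes "universal b C D f x y"
  obtains u where "y \<in> obj C" "arr b D x (f 0 y) u"
    "\<And>z v. z \<in> obj C \<Longrightarrow> arr b D x (f 0 z) v \<Longrightarrow> \<exists>w. arr b C y z w \<and> cmp b D u (f 1 w) v"
    "\<And>z v w w'. arr b C y z w \<Longrightarrow> arr b C y z w' \<Longrightarrow> cmp b D u (f 1 w) v \<Longrightarrow>
      cmp b D u (f 1 w') v \<Longrightarrow> hom_eq b C w w'"
  using assms unfolding universal_def by blast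

lemma universal_obj:
  "universal b C D f x y \<Longrightarrow> y \<in> obj C"
  "quasicategory D \<Longrightarrow> universal b C D f x y \<Longrightarrow> x \<in> obj D"
  using arr_obj(1)[of D b x] unfolding universal_def by blast+

text \<open>
  This makes invariance of universal arrows under equivalence of y a case of their
  composition.
\<close>

lemma equivalent_universal:
  assumes C: "quasicategory C" and e: "equivalent C y y'"
  shows "universal b C C fid y y'"
proof -
  obtain u u' where u: "arr b C y y' u" "arr b C y' y u'"
    "cmp b C u u' (ident C y)" "cmp b C u' u (ident C y')"
    using e equivalent_iff[OF C, of y y' b] by blast
  have cancel: "cmp b C u' v w" if "arr b C y' z w" "cmp b C u w v" for z v w
    using cmp_assoc[OF C u(4) that(2)] cmp_ident(1)[OF C that(1)] by blast
  have ex: "\<exists>w. arr b C y' z w \<and> cmp b C u w v" if v: "arr b C y z v" for z v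
  proof -
    obtain w where w: "cmp b C u' v w" "arr b C y' z w" using cmp_exists[OF C u(2) v] .
    then show ?thesis using cmp_assoc[OF C u(3) w(1)] cmp_ident(1)[OF C v] by blast
  qed
  show ?thesis
  proof (rule universalI[where u = u])
    show "y' \<in> obj C" by (rule arr_obj(2)[OF C u(1)])
    show "hom_eq b C w w'" if "arr b C y' z w" "arr b C y' z w'" "cmp b C u (fid 1 w) v"
      "cmp b C u (fid 1 w') v" for z v w w'
      using hom_eqI[OF C cancel[OF that(1)] cancel[OF that(2)]] that(3,4) by (simp add: fid_def)
  qed (use u(1) ex in \<open>simp_all add: fid_def\<close>)
qed

lemma universal_fid: "quasicategory C \<Longrightarrow> x \<in> obj C \<Longrightarrow> universal b C C fid x x"
  by (rule equivalent_universal[OF _ equivalent_refl])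

text \<open>
  An arrow from x to \<open>g (f a)\<close> factors first through \<open>g\<close> of an arrow from y to \<open>f a\<close>, and that one
  through \<open>f\<close> of an arrow from z to a; each factorization is unique up to homotopy.
\<close>

lemma universal_comp:
  assumes C: "quasicategory C" and D: "quasicategory D" and E: "quasicategory E"
    and f: "smap C D f" and g: "smap D E g"
    and gx: "universal b D E g x y" and fy: "universal b C D f y z"
  shows "universal b C E (g \<bullet> f) x z"
proof -
  obtain u where y: "y \<in> obj D" and u: "arr b E x (g 0 y) u"
    and uex: "\<And>a v. a \<in> obj D \<Longrightarrow> arr b E x (g 0 a) v \<Longrightarrow> \<exists>w. arr b D y a w \<and> cmp b E u (g 1 w) v"
    and uun: "\<And>a v w w'. arr b D y a w \<Longrightarrow> arr b D y a w' \<Longrightarrow> cmp b E u (g 1 w) v \<Longrightarrow>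
      cmp b E u (g 1 w') v \<Longrightarrow> hom_eq b D w w'"
    using gx by (rule universalD) blast
  obtain v where z: "z \<in> obj C" and v: "arr b D y (f 0 z) v"
    and vex: "\<And>a s. a \<in> obj C \<Longrightarrow> arr b D y (f 0 a) s \<Longrightarrow> \<exists>w. arr b C z a w \<and> cmp b D v (f 1 w) s"
    and vun: "\<And>a s w w'. arr b C z a w \<Longrightarrow> arr b C z a w' \<Longrightarrow> cmp b D v (f 1 w) s \<Longrightarrow>
      cmp b D v (f 1 w') s \<Longrightarrow> hom_eq b C w w'"
    using fy by (rule universalD) blast
  obtain t where t: "cmp b E u (g 1 v) t" and t': "arr b E x (g 0 (f 0 z)) t"
    using cmp_exists[OF E u smap_arr[OF g v]] .
  have ex: "\<exists>w. arr b C z a w \<and> cmp b E t (g 1 (f 1 w)) s"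
    if a: "a \<in> obj C" "arr b E x (g 0 (f 0 a)) s" for a s
  proof -
    obtain q where q: "arr b D y (f 0 a) q" "cmp b E u (g 1 q) s"
      using uex[OF _ a(2)] smap_cells[OF f a(1)] by blast
    obtain w where w: "arr b C z a w" "cmp b D v (f 1 w) q" using vex[OF a(1) q(1)] by blast
    have "cmp b E t (g 1 (f 1 w)) s"
      using cmp_assoc[OF E t smap_cmp[OF g w(2)]] q(2) by blast
    then show ?thesis using w(1) by blast
  qed
  have factor: "\<exists>q. arr b D y (f 0 a) q \<and> cmp b D v (f 1 w) q \<and> cmp b E u (g 1 q) s"
    if w: "arr b C z a w" "cmp b E t (g 1 (f 1 w)) s" for a s w
  proof -
    obtain q where q: "cmp b D v (f 1 w) q" "arr b D y (f 0 a) q"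
      using cmp_exists[OF D v smap_arr[OF f w(1)]] .
    then show ?thesis using cmp_assoc[OF E t smap_cmp[OF g q(1)]] w(2) by blast
  qed
  have un: "hom_eq b C w w'"
    if w: "arr b C z a w" "arr b C z a w'" "cmp b E t (g 1 (f 1 w)) s" "cmp b E t (g 1 (f 1 w')) s"
    for a s w w'
  proof -
    obtain q q' where q: "arr b D y (f 0 a) q" "cmp b D v (f 1 w) q" "cmp b E u (g 1 q) s"
      and q': "arr b D y (f 0 a) q'" "cmp b D v (f 1 w') q'" "cmp b E u (g 1 q') s"
      using factor[OF w(1,3)] factor[OF w(2,4)] by blast
    have "hom_eq b D q q'" using uun[OF q(1) q'(1) q(3) q'(3)] .
    then have "cmp b D v (f 1 w) q'" using cmp_cong_result[OF D _ q(2)] by blast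
    then show ?thesis using vun[OF w(1,2) _ q'(2)] by blast
  qed
  show ?thesis
    by (rule universalI[where u = t]) (use z t' ex un in \<open>simp_all only: fcomp_def\<close>)
qed

lemma universal_equivalent:
  assumes C: "quasicategory C" and D: "quasicategory D" and f: "smap C D f"
    and x: "universal b C D f x y" and e: "equivalent C y y'"
  shows "universal b C D f x y'"
  using universal_comp[OF C C D smap_fid f x equivalent_universal[OF C e]] by (simp add: fcomp_def fid_def)

text \<open>
  Universality yields arrows between y and y' in both directions. Each composite loop and the
  identity induce the same universal arrow, hence are homotopic.
\<close>

lemma universal_unique:
  assumes C: "quasicategory C" and D: "quasicategory D" and f: "smap C D f"
    and y: "universal b C D f x y" and y': "universal b C D f x y'"
  shows "equivalent C y y'"
proof -
  \<comment> \<open>stated for a generic pair so that it also covers the composite in the other order\<close>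
  have loop: "cmp b C w w' (ident C p)"
    if p: "p \<in> obj C" and u: "arr b D x (f 0 p) u"
    and un: "\<And>z v w w'. arr b C p z w \<Longrightarrow> arr b C p z w' \<Longrightarrow> cmp b D u (f 1 w) v \<Longrightarrow>
      cmp b D u (f 1 w') v \<Longrightarrow> hom_eq b C w w'"
    and w: "arr b C p q w" "arr b C q p w'" "cmp b D u (f 1 w) u'" "cmp b D u' (f 1 w') u"
    for p q u u' w w'
  proof -
    obtain e where e: "cmp b C w w' e" "arr b C p p e" using cmp_exists[OF C w(1,2)] .
    have "cmp b D u (f 1 e) u" using cmp_assoc[OF D w(3) smap_cmp[OF f e(1)]] w(4) by blast
    moreover have "cmp b D u (f 1 (ident C p)) u"
      using cmp_ident(2)[OF D u] smap_ident[OF f p] by simp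
    ultimately have "hom_eq b C e (ident C p)" using un[OF e(2) arr_ident[OF C p]] by blast
    then show ?thesis using cmp_cong_result[OF C _ e(1)] by blast
  qed
  obtain u where u: "y \<in> obj C" "arr b D x (f 0 y) u"
    "\<And>z v. z \<in> obj C \<Longrightarrow> arr b D x (f 0 z) v \<Longrightarrow> \<exists>w. arr b C y z w \<and> cmp b D u (f 1 w) v"
    "\<And>z v w w'. arr b C y z w \<Longrightarrow> arr b C y z w' \<Longrightarrow> cmp b D u (f 1 w) v \<Longrightarrow>
      cmp b D u (f 1 w') v \<Longrightarrow> hom_eq b C w w'"
    using y by (rule universalD) blast
  obtain u' where u': "y' \<in> obj C" "arr b D x (f 0 y') u'"
    "\<And>z v. z \<in> obj C \<Longrightarrow> arr b D x (f 0 z) v \<Longrightarrow> \<exists>w. arr b C y' z w \<and> cmp b D u' (f 1 w) v"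
    "\<And>z v w w'. arr b C y' z w \<Longrightarrow> arr b C y' z w' \<Longrightarrow> cmp b D u' (f 1 w) v \<Longrightarrow>
      cmp b D u' (f 1 w') v \<Longrightarrow> hom_eq b C w w'"
    using y' by (rule universalD) blast
  obtain w where w: "arr b C y y' w" "cmp b D u (f 1 w) u'" using u(3)[OF u'(1,2)] by blast
  obtain w' where w': "arr b C y' y w'" "cmp b D u' (f 1 w') u" using u'(3)[OF u(1,2)] by blast
  have "cmp b C w w' (ident C y)"
    by (rule loop[OF u(1,2) _ w(1) w'(1) w(2) w'(2)]) (rule u(4))
  moreover have "cmp b C w' w (ident C y')"
    by (rule loop[OF u'(1,2) _ w'(1) w(1) w'(2) w(2)]) (rule u'(4))
  ultimately show ?thesis
    unfolding equivalent_iff[OF C, of y y' b] using w(1) w'(1) by blast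
qed

text \<open>
  The classical argument, read in the homotopy category: the arrow corresponding to \<open>v\<close> from x to
  \<open>f z\<close> is \<open>l v\<close> followed by the counit at z. Naturality of the unit and the triangle identity for f
  show that it factors \<open>v\<close>; naturality of the counit and the triangle identity for l show that every
  factorization of \<open>v\<close> is a composite of \<open>l v\<close> and the counit, whence uniqueness.
\<close>

lemma universal_of_triangles:
  assumes C: "quasicategory C" and D: "quasicategory D"
    and f: "smap C D f" and l: "smap D C l" and x: "x \<in> obj D"
    and eta: "\<And>x. x \<in> obj D \<Longrightarrow> arr b D x (f 0 (l 0 x)) (eta x)"
    and eps: "\<And>z. z \<in> obj C \<Longrightarrow> arr b C (l 0 (f 0 z)) z (eps z)"
    and eta_nat: "\<And>x y v. arr b D x y v \<Longrightarrow>
      \<exists>d. cmp b D (eta x) (f 1 (l 1 v)) d \<and> cmp b D v (eta y) d"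
    and eps_nat: "\<And>y z w. arr b C y z w \<Longrightarrow>
      \<exists>d. cmp b C (l 1 (f 1 w)) (eps z) d \<and> cmp b C (eps y) w d"
    and tri_l: "\<And>x. x \<in> obj D \<Longrightarrow> cmp b C (l 1 (eta x)) (eps (l 0 x)) (ident C (l 0 x))"
    and tri_f: "\<And>z. z \<in> obj C \<Longrightarrow> cmp b D (eta (f 0 z)) (f 1 (eps z)) (ident D (f 0 z))"
  shows "universal b C D f x (l 0 x)"
proof -
  have lx: "l 0 x \<in> obj C" using smap_cells[OF l x] .
  have ex: "\<exists>w. arr b C (l 0 x) z w \<and> cmp b D (eta x) (f 1 w) v"
    if z: "z \<in> obj C" and v: "arr b D x (f 0 z) v" for z v
  proof -
    obtain w where w: "cmp b C (l 1 v) (eps z) w" "arr b C (l 0 x) z w"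
      using cmp_exists[OF C smap_arr[OF l v] eps[OF z]] .
    obtain d where d: "cmp b D (eta x) (f 1 (l 1 v)) d" "cmp b D v (eta (f 0 z)) d"
      using eta_nat[OF v] by blast
    have "cmp b D d (f 1 (eps z)) v"
      using cmp_assoc[OF D d(2) tri_f[OF z]] cmp_ident(2)[OF D v] by blast
    then show ?thesis using cmp_assoc[OF D d(1) smap_cmp[OF f w(1)]] w(2) by blast
  qed
  have transpose: "cmp b C (l 1 v) (eps z) w"
    if w: "arr b C (l 0 x) z w" "cmp b D (eta x) (f 1 w) v" for z v w
  proof -
    obtain d where d: "cmp b C (l 1 (f 1 w)) (eps z) d" "cmp b C (eps (l 0 x)) w d"
      using eps_nat[OF w(1)] by blast
    have "cmp b C (l 1 (eta x)) d w"
      using cmp_assoc[OF C tri_l[OF x] d(2)] cmp_ident(1)[OF C w(1)] by blast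
    then show ?thesis using cmp_assoc[OF C smap_cmp[OF l w(2)] d(1)] by blast
  qed
  show ?thesis
    by (rule universalI[where u = "eta x", OF lx eta[OF x] ex hom_eqI[OF C transpose transpose]])
qed

text \<open>
  The part of an adjunction that survives evaluation at objects, in the form required by
  \<open>universal_of_triangles\<close>.
\<close>

lemma adjunction_triangles:
  assumes C: "is_sset C" and D: "is_sset D" and a: "adjunction C D f g eta eps"
  shows "x \<in> obj C \<Longrightarrow> edge C x (g 0 (f 0 x)) (component C eta x)"
    and "z \<in> obj D \<Longrightarrow> edge D (f 0 (g 0 z)) z (component D eps z)"
    and "edge C x y v \<Longrightarrow>
      \<exists>d. composite C (component C eta x) (g 1 (f 1 v)) d \<and> composite C v (component C eta y) d"
    and "edge D z z' w \<Longrightarrow>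
      \<exists>d. composite D (f 1 (g 1 w)) (component D eps z') d \<and> composite D (component D eps z) w d"
    and "x \<in> obj C \<Longrightarrow>
      composite D (f 1 (component C eta x)) (component D eps (f 0 x)) (ident D (f 0 x))"
    and "z \<in> obj D \<Longrightarrow>
      composite C (component C eta (g 0 z)) (g 1 (component D eps z)) (ident C (g 0 z))"
proof -
  have f: "smap C D f" and g: "smap D C g"
    and eta: "nat_trans C C fid (g \<bullet> f) eta" and eps: "nat_trans D D (f \<bullet> g) fid eps"
    and tf: "composite (Fun C D) (postw C f eta) (prew C f eps) (ident (Fun C D) (fvertex C f))"
    and tg: "composite (Fun D C) (prew D g eta) (postw D g eps) (ident (Fun D C) (fvertex D g))"
    using a unfolding adjunction_def by blast+
  show "edge C x (g 0 (f 0 x)) (component C eta x)" if "x \<in> obj C"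
    using component_nat_trans[OF C that eta] by (simp add: fcomp_def fid_def)
  show "edge D (f 0 (g 0 z)) z (component D eps z)" if "z \<in> obj D"
    using component_nat_trans[OF D that eps] by (simp add: fcomp_def fid_def)
  show "\<exists>d. composite C (component C eta x) (g 1 (f 1 v)) d \<and> composite C v (component C eta y) d"
    if "edge C x y v"
    using component_naturality[OF C smap_fid smap_comp[OF f g] eta that]
    by (simp add: fcomp_def fid_def) blast
  show "\<exists>d. composite D (f 1 (g 1 w)) (component D eps z') d \<and> composite D (component D eps z) w d"
    if "edge D z z' w"
    using component_naturality[OF D smap_comp[OF g f] smap_fid eps that]
    by (simp add: fcomp_def fid_def) blast
  show "composite D (f 1 (component C eta x)) (component D eps (f 0 x)) (ident D (f 0 x))"
    if "x \<in> obj C"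
    using component_composite[OF C that tf]
    by (simp add: component_postw[OF C that] component_prew[OF C f that] component_ident_vertex[OF C that f])
  show "composite C (component C eta (g 0 z)) (g 1 (component D eps z)) (ident C (g 0 z))"
    if "z \<in> obj D"
    using component_composite[OF D that tg]
    by (simp add: component_postw[OF D that] component_prew[OF D g that] component_ident_vertex[OF D that g])
qed

text \<open>
  For a right adjoint the arrow is the counit, which is a unit after reversal of arrows.
\<close>

lemma adj_universal:
  assumes C: "quasicategory C" and D: "quasicategory D" and a: "adj b C D l f" and x: "x \<in> obj D"
  shows "universal b C D f x (l 0 x)"
proof (cases b)
  case True
  then obtain eta eps where a: "adjunction D C l f eta eps"
    using a by (auto simp: adj_def adjoint_pair_def)
  note t = adjunction_triangles[OF quasicategory_sset[OF D] quasicategory_sset[OF C] a]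
  have "smap C D f" "smap D C l" using a by (simp_all add: adjunction_def)
  then show ?thesis
    by (rule universal_of_triangles[OF C D _ _ x, where eta = "component D eta" and eps = "component C eps"])
      (simp_all only: True arr_def cmp_def if_True t)
next
  case False
  then obtain eta eps where a: "adjunction C D f l eta eps"
    using a by (auto simp: adj_def adjoint_pair_def)
  note t = adjunction_triangles[OF quasicategory_sset[OF C] quasicategory_sset[OF D] a]
  have "smap C D f" "smap D C l" using a by (simp_all add: adjunction_def)
  then show ?thesis
    by (rule universal_of_triangles[OF C D _ _ x, where eta = "component D eps" and eps = "component C eta"])
      (simp_all only: False arr_def cmp_def if_False t)
qed


section \<open>Beck-Chevalley squares transport universal arrows\<close>

lemma composite3_edge:
  assumes X: "is_sset C" and c: "composite3 C u v w r" and u: "edge C x y u" and w: "edge C y' z w"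
  shows "edge C x z r"
proof -
  obtain p where p: "composite C u v p" "composite C p w r"
    using c unfolding composite3_def by blast
  obtain x1 y1 z1 where e: "edge C x1 y1 u" "edge C x1 z1 p" using composite_edges[OF X p(1)] .
  have "x1 = x" using e(1) u by (simp add: edge_def)
  then show ?thesis using composite_endpoints(2)[OF X p(2) _ w] e(2) by blast
qed

lemma component_composite3:
  assumes "is_sset C" "x \<in> obj C" "composite3 (Fun C D) u v w r"
  shows "composite3 D (component C u x) (component C v x) (component C w x) (component C r x)"
  using assms(3) component_composite[OF assms(1,2)] unfolding composite3_def by blast

text \<open>
  The mate is an equivalence in \<open>Fun B C\<close>, so its components are equivalences in C. Their source is
  that of the whiskered unit and their target that of the whiskered counit, which gives the two objects
  to be compared.
\<close>

lemma left_BC_equivalent: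
  assumes B: "is_sset B" and C: "is_sset C" and A: "is_sset A" and E: "is_sset E"
    and g: "smap A C g" and u: "smap B E u" and bc: "left_BC A B C E a h g u \<theta>"
  shows "\<exists>l k. adj True A B l a \<and> adj True C E k h \<and>
    (\<forall>x\<in>obj B. equivalent C (k 0 (u 0 x)) (g 0 (l 0 x)))"
proof -
  obtain l k eta_a eps_a eta_h eps_h m
    where l: "adjunction B A l a eta_a eps_a" and k: "adjunction E C k h eta_h eps_h"
    and c: "composite3 (Fun B C) (postw B (k \<bullet> u) eta_a) (postw B k (prew B l \<theta>))
          (prew B (g \<bullet> l) eps_h) m" and m: "equivalence (Fun B C) m"
    using bc unfolding left_BC_def by blast
  have sl: "smap B A l" and sk: "smap E C k" using l k by (simp_all add: adjunction_def)
  have "equivalent C (k 0 (u 0 x)) (g 0 (l 0 x))" if x: "x \<in> obj B" for x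
  proof -
    have glx: "g 0 (l 0 x) \<in> obj C" using smap_cells[OF g smap_cells[OF sl x]] .
    have "edge C (k 0 (u 0 x)) (k 0 (u 0 (a 0 (l 0 x)))) (component B (postw B (k \<bullet> u) eta_a) x)"
      using smap_edge[OF smap_comp[OF u sk] adjunction_triangles(1)[OF B A l x]]
      by (simp add: component_postw[OF B x] fcomp_def)
    moreover have "edge C (k 0 (h 0 (g 0 (l 0 x)))) (g 0 (l 0 x)) (component B (prew B (g \<bullet> l) eps_h) x)"
      unfolding component_prew[OF B smap_comp[OF sl g] x]
      using adjunction_triangles(2)[OF E C k glx] by (simp add: fcomp_def)
    ultimately have "edge C (k 0 (u 0 x)) (g 0 (l 0 x)) (component B m x)"
      using composite3_edge[OF C component_composite3[OF B x c]] by blast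
    then show ?thesis using component_equivalence[OF B x m] unfolding equivalent_def by blast
  qed
  then show ?thesis using l k unfolding adj_def adjoint_pair_def by auto
qed

lemma right_BC_equivalent:
  assumes B: "is_sset B" and C: "is_sset C" and A: "is_sset A" and E: "is_sset E"
    and g: "smap A C g" and u: "smap B E u" and bc: "right_BC A B C E a h g u \<theta>"
  shows "\<exists>l k. adj False A B l a \<and> adj False C E k h \<and>
    (\<forall>x\<in>obj B. equivalent C (g 0 (l 0 x)) (k 0 (u 0 x)))"
proof -
  obtain l k eta_a eps_a eta_h eps_h \<theta>' m
    where l: "adjunction A B a l eta_a eps_a" and k: "adjunction C E h k eta_h eps_h"
    and c: "composite3 (Fun B C) (prew B (g \<bullet> l) eta_h) (postw B k (prew B l \<theta>'))
          (postw B (k \<bullet> u) eps_a) m" and m: "equivalence (Fun B C) m"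
    using bc unfolding right_BC_def by blast
  have sl: "smap B A l" and sk: "smap E C k" using l k by (simp_all add: adjunction_def)
  have "equivalent C (g 0 (l 0 x)) (k 0 (u 0 x))" if x: "x \<in> obj B" for x
  proof -
    have glx: "g 0 (l 0 x) \<in> obj C" using smap_cells[OF g smap_cells[OF sl x]] .
    have "edge C (k 0 (u 0 (a 0 (l 0 x)))) (k 0 (u 0 x)) (component B (postw B (k \<bullet> u) eps_a) x)"
      using smap_edge[OF smap_comp[OF u sk] adjunction_triangles(2)[OF A B l x]]
      by (simp add: component_postw[OF B x] fcomp_def)
    moreover have "edge C (g 0 (l 0 x)) (k 0 (h 0 (g 0 (l 0 x)))) (component B (prew B (g \<bullet> l) eta_h) x)"
      unfolding component_prew[OF B smap_comp[OF sl g] x]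
      using adjunction_triangles(1)[OF C E k glx] by (simp add: fcomp_def)
    ultimately have "edge C (g 0 (l 0 x)) (k 0 (u 0 x)) (component B m x)"
      using composite3_edge[OF C component_composite3[OF B x c]] by blast
    then show ?thesis using component_equivalence[OF B x m] unfolding equivalent_def by blast
  qed
  then show ?thesis using l k unfolding adj_def adjoint_pair_def by auto
qed

text \<open>
  The adjoints in the Beck-Chevalley condition represent some universal arrows; by uniqueness up to
  equivalence the conclusion passes to every representing object y.
\<close>

lemma BC_square_universal:
  assumes A: "quasicategory A" and B: "quasicategory B" and C: "quasicategory C"
    and E: "quasicategory E" and a: "smap A B a" and h: "smap C E h"
    and g: "smap A C g" and u: "smap B E u" and bc: "BC_square A B C E a h g u \<theta>"
    and y: "universal b A B a x y"
  shows "universal b C E h (u 0 x) (g 0 y)"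
proof -
  note X = quasicategory_sset[OF A] quasicategory_sset[OF B] quasicategory_sset[OF C]
    quasicategory_sset[OF E]
  obtain l k where l: "adj b A B l a" and k: "adj b C E k h"
    and eq: "\<forall>x\<in>obj B. equivalent C (k 0 (u 0 x)) (g 0 (l 0 x))"
  proof (cases b)
    case True
    then show ?thesis
      using left_BC_equivalent[OF X(2,3,1,4) g u, of a h \<theta>] bc that unfolding BC_square_def by auto
  next
    case False
    then show ?thesis
      using right_BC_equivalent[OF X(2,3,1,4) g u, of a h \<theta>] bc that equivalent_sym[OF C]
      unfolding BC_square_def by (metis (full_types))
  qed
  have x: "x \<in> obj B" using universal_obj(2)[OF B y] .
  have "equivalent A (l 0 x) y" using universal_unique[OF A B a adj_universal[OF A B l x] y] .
  then have "equivalent C (g 0 (l 0 x)) (g 0 y)" by (rule smap_equivalent[OF A C g])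
  moreover have "universal b C E h (u 0 x) (g 0 (l 0 x))"
    using universal_equivalent[OF C E h adj_universal[OF C E k smap_cells[OF u x]]] eq x by blast
  ultimately show ?thesis using universal_equivalent[OF C E h] by blast
qed

section \<open>Leafwise description of iterated gluing\<close>

definition side :: "bool \<Rightarrow> 'a tpair \<Rightarrow> 'a set" where
  "side b t = (if b then fst t else snd t)"

text \<open>
  The class described in the introduction, on the interval \<open>[i,k]\<close>. Since representing objects are
  unique up to equivalence and the classes on the leaves are closed under equivalence, some
  representing object lies in the class of the leaf if and only if all do. For \<open>m = k\<close> the functor is
  the identity of the leaf.
\<close>

definition leafwise :: "bool \<Rightarrow> 'a compass \<Rightarrow> (nat \<Rightarrow> 'a tpair) \<Rightarrow> nat \<Rightarrow> nat \<Rightarrow> 'a set" where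
  "leafwise b G t i k = {x \<in> obj (cat G i k). \<forall>m\<in>{i..k}. \<exists>y\<in>side b (t m).
     universal b (cat G m m) (cat G m k) (incs G m m (k - m)) (ress G i k (m - i) 0 x) y}"

lemma incs_add: "incs G i j (d + e) = incs G i (j + d) e \<bullet> incs G i j d"
  by (induction e) (simp_all add: fcomp_def fid_def add.assoc)

lemma ress_add: "ress G i k (d + e) = ress G (i + d) k e \<bullet> ress G i k d"
  by (induction e) (simp_all add: fcomp_def fid_def add.assoc)

text \<open>
  Composition of adjoints as a test for membership: given the first reflection z of x, the second
  reflection of z and the total reflection of x agree up to equivalence.
\<close>

lemma universal_comp_replete_iff:
  assumes C: "quasicategory C" and D: "quasicategory D" and E: "quasicategory E"
    and f: "smap C D f" and g: "smap D E g" and x: "universal b D E g x z"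
    and ex: "universal b C D f z y0" and S: "replete C S"
  shows "(\<exists>y\<in>S. universal b C E (g \<bullet> f) x y) \<longleftrightarrow> (\<exists>y\<in>S. universal b C D f z y)"
proof
  assume "\<exists>y\<in>S. universal b C D f z y"
  then show "\<exists>y\<in>S. universal b C E (g \<bullet> f) x y" using universal_comp[OF C D E f g x] by blast
next
  assume "\<exists>y\<in>S. universal b C E (g \<bullet> f) x y"
  then obtain y where y: "y \<in> S" "universal b C E (g \<bullet> f) x y" by blast
  have e: "equivalent C y y0"
    by (rule universal_unique[OF C E smap_comp[OF f g] y(2) universal_comp[OF C D E f g x ex]])
  have "y0 \<in> S" using S y(1) e equivalent_obj[OF C e] unfolding replete_def by blast
  then show "\<exists>y\<in>S. universal b C D f z y" using ex by blast
qed

text \<open>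
  The adjoint chosen in the definition of \<open>glue\<close> is an adjoint, as a recollement provides one.
\<close>

lemma side_glue:
  assumes D: "recollement D0 D D1 i q"
  obtains l where "adj b D0 D l i" "side b (glue D0 D D1 i q t0 t1) =
    {x \<in> obj D. q 0 x \<in> side b t1 \<and> l 0 x \<in> side b t0}"
proof (cases b)
  case True
  have "\<exists>l. adjoint_pair D D0 l i" using D unfolding recollement_def adjoint_pair_def by blast
  then have "adjoint_pair D D0 (left_adj D0 D i) i" unfolding left_adj_def by (rule someI_ex)
  with True show ?thesis by (intro that[of "left_adj D0 D i"]) (auto simp: adj_def side_def glue_def)
next
  case False
  have "\<exists>r. adjoint_pair D0 D i r" using D unfolding recollement_def adjoint_pair_def by blast
  then have "adjoint_pair D0 D i (right_adj D0 D i)" unfolding right_adj_def by (rule someI_ex)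
  with False show ?thesis by (intro that[of "right_adj D0 D i"]) (auto simp: adj_def side_def glue_def)
qed

context
  fixes n :: nat and G :: "'a compass"
  assumes G: "urizen_compass n G"
begin

lemma compass_parts:
  shows cat_stable: "i \<le> j \<Longrightarrow> j \<le> n \<Longrightarrow> stable (cat G i j)"
    and inc_biadjoint: "i \<le> j \<Longrightarrow> j < n \<Longrightarrow> biadjoint (cat G i j) (cat G i (Suc j)) (inc G i j)"
    and res_biadjoint: "i < j \<Longrightarrow> j \<le> n \<Longrightarrow> biadjoint (cat G i j) (cat G (Suc i) j) (res G i j)"
    and compass_recollement: "i \<le> j \<Longrightarrow> j < k \<Longrightarrow> k \<le> n \<Longrightarrow>
      recollement (cat G i j) (cat G i k) (cat G (Suc j) k)
        (incs G i j (k - j)) (ress G i k (Suc j - i))"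
    and compass_BC: "i < j \<Longrightarrow> j < n \<Longrightarrow>
      BC_square (cat G i j) (cat G i (Suc j)) (cat G (Suc i) j) (cat G (Suc i) (Suc j))
        (inc G i j) (inc G (Suc i) j) (res G i j) (res G i (Suc j)) (cell2 G i j)"
proof -
  note parts = G[unfolded urizen_compass_def]
  note stable = conjunct1[OF parts] and parts = conjunct2[OF parts]
  note inc = conjunct1[OF parts] and parts = conjunct2[OF parts]
  note res = conjunct1[OF parts] and parts = conjunct2[OF parts]
  note rec = conjunct1[OF parts] and BC = conjunct2[OF parts]
  show "i \<le> j \<Longrightarrow> j \<le> n \<Longrightarrow> stable (cat G i j)"
    using stable[rule_format, of i j] by simp
  show "i \<le> j \<Longrightarrow> j < n \<Longrightarrow> biadjoint (cat G i j) (cat G i (Suc j)) (inc G i j)"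
    using inc[rule_format, of i j] by simp
  show "i < j \<Longrightarrow> j \<le> n \<Longrightarrow> biadjoint (cat G i j) (cat G (Suc i) j) (res G i j)"
    using res[rule_format, of i j] by simp
  show "i \<le> j \<Longrightarrow> j < k \<Longrightarrow> k \<le> n \<Longrightarrow> recollement (cat G i j) (cat G i k) (cat G (Suc j) k)
      (incs G i j (k - j)) (ress G i k (Suc j - i))"
    using rec[rule_format, of i j k] by simp
  show "i < j \<Longrightarrow> j < n \<Longrightarrow>
      BC_square (cat G i j) (cat G i (Suc j)) (cat G (Suc i) j) (cat G (Suc i) (Suc j))
        (inc G i j) (inc G (Suc i) j) (res G i j) (res G i (Suc j)) (cell2 G i j)"
    using BC[rule_format, of i j] by simp
qed

lemma cat_quasicategory: "i \<le> j \<Longrightarrow> j \<le> n \<Longrightarrow> quasicategory (cat G i j)"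
  using cat_stable[of i j] by (simp add: stable_def)

lemma inc_smap: "i \<le> j \<Longrightarrow> j < n \<Longrightarrow> smap (cat G i j) (cat G i (Suc j)) (inc G i j)"
  using inc_biadjoint[of i j] by (simp add: biadjoint_def)

lemma res_smap: "i < j \<Longrightarrow> j \<le> n \<Longrightarrow> smap (cat G i j) (cat G (Suc i) j) (res G i j)"
  using res_biadjoint[of i j] by (simp add: biadjoint_def)

lemma incs_smap: "i \<le> j \<Longrightarrow> j + d \<le> n \<Longrightarrow> smap (cat G i j) (cat G i (j + d)) (incs G i j d)"
proof (induction d)
  case (Suc d)
  then show ?case using smap_comp[OF Suc.IH inc_smap[of i "j + d"]] by simp
qed (simp add: smap_fid)

lemma ress_smap: "i + d \<le> k \<Longrightarrow> k \<le> n \<Longrightarrow> smap (cat G i k) (cat G (i + d) k) (ress G i k d)"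
proof (induction d)
  case (Suc d)
  then show ?case using smap_comp[OF Suc.IH res_smap[of "i + d" k]] by simp
qed (simp add: smap_fid)

lemma inc_universal_exists:
  assumes "i \<le> j" "j < n" "x \<in> obj (cat G i (Suc j))"
  shows "\<exists>y. universal b (cat G i j) (cat G i (Suc j)) (inc G i j) x y"
proof -
  have "\<exists>l. adj b (cat G i j) (cat G i (Suc j)) l (inc G i j)"
    using inc_biadjoint[OF assms(1,2)] unfolding biadjoint_def adj_def by (cases b) auto
  then obtain l where l: "adj b (cat G i j) (cat G i (Suc j)) l (inc G i j)" ..
  have "quasicategory (cat G i j)" "quasicategory (cat G i (Suc j))"
    using cat_quasicategory[of i j] cat_quasicategory[of i "Suc j"] assms(1,2) by auto
  from adj_universal[OF this l assms(3)] show ?thesis by blast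
qed

lemma incs_universal_exists:
  assumes "i \<le> j" "j + d \<le> n" "x \<in> obj (cat G i (j + d))"
  shows "\<exists>y. universal b (cat G i j) (cat G i (j + d)) (incs G i j d) x y"
  using assms(2,3)
proof (induction d arbitrary: x)
  case 0
  then show ?case using universal_fid[OF cat_quasicategory[of i j], of x b] assms(1) by auto
next
  case (Suc d)
  have le: "i \<le> j + d" "j + d < n" "j + d \<le> n" "i \<le> Suc (j + d)" "Suc (j + d) \<le> n" "j \<le> n"
    using Suc.prems(1) assms(1) by auto
  obtain z where z: "universal b (cat G i (j + d)) (cat G i (Suc (j + d))) (inc G i (j + d)) x z"
    using inc_universal_exists[OF le(1,2)] Suc.prems(2) by auto
  have "z \<in> obj (cat G i (j + d))" using z by (rule universal_obj)
  then obtain y where "universal b (cat G i j) (cat G i (j + d)) (incs G i j d) z y"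
    using Suc.IH[OF le(3)] by blast
  from z this have "universal b (cat G i j) (cat G i (Suc (j + d))) (inc G i (j + d) \<bullet> incs G i j d) x y"
    by (rule universal_comp[OF cat_quasicategory[OF assms(1) le(6)] cat_quasicategory[OF le(1,3)]
          cat_quasicategory[OF le(4,5)] incs_smap[OF assms(1) le(3)] inc_smap[OF le(1,2)]])
  then show ?case by auto
qed

text \<open>
  Pasting of Beck-Chevalley squares, carried out on representing objects instead of on
  transformations. The inclusion of \<open>[i,j]\<close> into \<open>[i,j+d]\<close> is factored into elementary ones; a
  representing object y is equivalent to one obtained in steps, and each step is an elementary square.
  The assumption \<open>i < j\<close> is what makes all these squares available.
\<close>

lemma res_universal:
  assumes "i < j" "j + d \<le> n" "universal b (cat G i j) (cat G i (j + d)) (incs G i j d) x y"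
  shows "universal b (cat G (Suc i) j) (cat G (Suc i) (j + d)) (incs G (Suc i) j d)
    (res G i (j + d) 0 x) (res G i j 0 y)"
  using assms(2,3)
proof (induction d arbitrary: x y)
  case 0
  have q: "quasicategory (cat G i j)" "quasicategory (cat G (Suc i) j)"
    using cat_quasicategory 0 assms(1) by auto
  have y: "universal b (cat G i j) (cat G i j) fid x y" using 0 by simp
  have "x \<in> obj (cat G i j)" using universal_obj(2)[OF q(1) y] .
  then have "equivalent (cat G i j) x y"
    using universal_unique[OF q(1) q(1) smap_fid universal_fid[OF q(1)] y] by blast
  then have "equivalent (cat G (Suc i) j) (res G i j 0 x) (res G i j 0 y)"
    using smap_equivalent[OF q res_smap] 0 assms(1) by simp
  then show ?case using equivalent_universal[OF q(2)] by simp
next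
  case (Suc d)
  let ?k = "j + d"
  have le: "i \<le> ?k" "?k < n" "?k \<le> n" "i \<le> Suc ?k" "Suc ?k \<le> n" "j \<le> n" "i \<le> j"
    "Suc i \<le> j" "Suc i \<le> ?k" "Suc i \<le> Suc ?k" "i < ?k" "i < Suc ?k"
    using Suc.prems(1) assms(1) by auto
  note q = cat_quasicategory[OF le(7,6)] cat_quasicategory[OF le(1,3)] cat_quasicategory[OF le(4,5)]
  note q' = cat_quasicategory[OF le(8,6)] cat_quasicategory[OF le(9,3)]
    cat_quasicategory[OF le(10,5)]
  have y: "universal b (cat G i j) (cat G i (Suc ?k)) (inc G i ?k \<bullet> incs G i j d) x y"
    using Suc.prems(2) by simp
  have "x \<in> obj (cat G i (Suc ?k))" using universal_obj(2)[OF q(3) y] .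
  then obtain z where z: "universal b (cat G i ?k) (cat G i (Suc ?k)) (inc G i ?k) x z"
    using inc_universal_exists[OF le(1,2)] by blast
  have "z \<in> obj (cat G i ?k)" using z by (rule universal_obj)
  then obtain y' where y': "universal b (cat G i j) (cat G i ?k) (incs G i j d) z y'"
    using incs_universal_exists[OF le(7,3)] by blast
  have "equivalent (cat G i j) y' y"
    using universal_unique[OF q(1,3) smap_comp[OF incs_smap[OF le(7,3)] inc_smap[OF le(1,2)]]
        universal_comp[OF q incs_smap[OF le(7,3)] inc_smap[OF le(1,2)] z y'] y] .
  then have e: "equivalent (cat G (Suc i) j) (res G i j 0 y') (res G i j 0 y)"
    using smap_equivalent[OF q(1) q'(1) res_smap] assms(1) le(6) by blast
  have "BC_square (cat G i ?k) (cat G i (Suc ?k)) (cat G (Suc i) ?k) (cat G (Suc i) (Suc ?k))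
      (inc G i ?k) (inc G (Suc i) ?k) (res G i ?k) (res G i (Suc ?k)) (cell2 G i ?k)"
    using compass_BC[OF le(11,2)] .
  then have rz: "universal b (cat G (Suc i) ?k) (cat G (Suc i) (Suc ?k)) (inc G (Suc i) ?k)
      (res G i (Suc ?k) 0 x) (res G i ?k 0 z)"
    using BC_square_universal[OF q(2,3) q'(2,3) inc_smap[OF le(1,2)] inc_smap[OF le(9,2)]
      res_smap[OF le(11,3)] res_smap[OF le(12,5)] _ z] by blast
  have "universal b (cat G (Suc i) j) (cat G (Suc i) (Suc ?k)) (inc G (Suc i) ?k \<bullet> incs G (Suc i) j d)
      (res G i (Suc ?k) 0 x) (res G i j 0 y')"
    using universal_comp[OF q' incs_smap[OF le(8,3)] inc_smap[OF le(9,2)] rz Suc.IH[OF le(3) y']] .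
  then show ?case
    using universal_equivalent[OF q'(1,3) smap_comp[OF incs_smap[OF le(8,3)] inc_smap[OF le(9,2)]] _ e]
    by simp
qed

lemma ress_universal:
  assumes "i + e \<le> j" "j + d \<le> n" "universal b (cat G i j) (cat G i (j + d)) (incs G i j d) x y"
  shows "universal b (cat G (i + e) j) (cat G (i + e) (j + d)) (incs G (i + e) j d)
    (ress G i (j + d) e 0 x) (ress G i j e 0 y)"
  using assms
proof (induction e)
  case 0
  then show ?case by (simp add: fid_def)
next
  case (Suc e)
  then show ?case using res_universal[of "i + e" j d] by (simp add: fcomp_def)
qed

text \<open>
  The inductive step. Leaves to the right of j are tested on the restriction of x, and
  restricting in two steps is restricting at once. Leaves m up to j are tested on the reflection \<open>l x\<close>; by
  \<open>ress_universal\<close> the restriction of \<open>l x\<close> to \<open>[m,j]\<close> represents the restriction of x to \<open>[m,k]\<close>, so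
  \<open>universal_comp_replete_iff\<close> identifies the test with that on x.
\<close>

lemma glue_leafwise:
  assumes ijk: "i \<le> j" "j < k" "k \<le> n"
    and t: "\<And>m. m \<le> n \<Longrightarrow> replete (cat G m m) (side b (t m))"
    and t0: "side b t0 = leafwise b G t i j" and t1: "side b t1 = leafwise b G t (Suc j) k"
  shows "side b (glue (cat G i j) (cat G i k) (cat G (Suc j) k)
    (incs G i j (k - j)) (ress G i k (Suc j - i)) t0 t1) = leafwise b G t i k"
proof -
  let ?i = "incs G i j (k - j)" and ?q = "ress G i k (Suc j - i)"
  have le: "i \<le> k" "j \<le> n" "Suc j \<le> k" using ijk by auto
  note q = cat_quasicategory[OF ijk(1) le(2)] cat_quasicategory[OF le(1) ijk(3)]
  have "recollement (cat G i j) (cat G i k) (cat G (Suc j) k) ?i ?q"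
    using compass_recollement[OF ijk] .
  then obtain l where l: "adj b (cat G i j) (cat G i k) l ?i"
    and glue: "side b (glue (cat G i j) (cat G i k) (cat G (Suc j) k) ?i ?q t0 t1) =
      {x \<in> obj (cat G i k). ?q 0 x \<in> side b t1 \<and> l 0 x \<in> side b t0}"
    by (rule side_glue)
  define leaf where "leaf i k x m \<longleftrightarrow> (\<exists>y\<in>side b (t m).
     universal b (cat G m m) (cat G m k) (incs G m m (k - m)) (ress G i k (m - i) 0 x) y)" for i k x m
  have leafwise: "leafwise b G t i k = {x \<in> obj (cat G i k). \<forall>m\<in>{i..k}. leaf i k x m}" for i k
    by (simp add: leafwise_def leaf_def)
  have right: "?q 0 x \<in> side b t1 \<longleftrightarrow> (\<forall>m\<in>{Suc j..k}. leaf i k x m)"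
    if x: "x \<in> obj (cat G i k)" for x
  proof -
    have "?q 0 x \<in> obj (cat G (Suc j) k)"
      using smap_cells[OF ress_smap[of i "Suc j - i" k], of x 0] x ijk by simp
    moreover have "leaf (Suc j) k (?q 0 x) m \<longleftrightarrow> leaf i k x m" if "m \<in> {Suc j..k}" for m
    proof -
      have "ress G i k (m - i) = ress G (Suc j) k (m - Suc j) \<bullet> ?q"
        using ress_add[of G i k "Suc j - i" "m - Suc j"] that ijk by simp
      then show ?thesis by (simp add: leaf_def fcomp_def)
    qed
    ultimately show ?thesis unfolding t1 leafwise by blast
  qed
  have left: "l 0 x \<in> side b t0 \<longleftrightarrow> (\<forall>m\<in>{i..j}. leaf i k x m)"
    if x: "x \<in> obj (cat G i k)" for x
  proof -
    have lx: "universal b (cat G i j) (cat G i k) ?i x (l 0 x)" using adj_universal[OF q l x] .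
    then have lobj: "l 0 x \<in> obj (cat G i j)" by (rule universal_obj)
    have "leaf i j (l 0 x) m \<longleftrightarrow> leaf i k x m" if m: "m \<in> {i..j}" for m
    proof -
      have mle: "m \<le> j" "m \<le> k" "m \<le> n" "m \<le> m" "m + (j - m) \<le> n" "m + (j - m) = j"
        "j + (k - j) = k" "i + (m - i) = m" "j + (k - j) \<le> n" "i + (m - i) \<le> j"
        "(j - m) + (k - j) = k - m" using m ijk by auto
      note qm = cat_quasicategory[OF mle(4,3)] cat_quasicategory[OF mle(1) le(2)]
        cat_quasicategory[OF mle(2) ijk(3)]
      let ?z = "ress G i j (m - i) 0 (l 0 x)"
      have z: "universal b (cat G m j) (cat G m k) (incs G m j (k - j)) (ress G i k (m - i) 0 x) ?z"
        using ress_universal[OF mle(10,9), of b x "l 0 x"] lx by (simp only: mle)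
      then have "?z \<in> obj (cat G m j)" by (rule universal_obj)
      then obtain y0 where y0: "universal b (cat G m m) (cat G m j) (incs G m m (j - m)) ?z y0"
        using incs_universal_exists[OF mle(4,5)] mle(6) by auto
      have "incs G m m (k - m) = incs G m j (k - j) \<bullet> incs G m m (j - m)"
        using incs_add[of G m m "j - m" "k - j"] mle by simp
      then show ?thesis
        unfolding leaf_def
        using universal_comp_replete_iff[OF qm _ _ z y0 t[OF mle(3)]] incs_smap[OF mle(4,5)]
          incs_smap[OF mle(1,9)] mle by simp
    qed
    then show ?thesis unfolding t0 leafwise using lobj by blast
  qed
  have "{i..k} = {i..j} \<union> {Suc j..k}" using ijk by auto
  then show ?thesis unfolding glue leafwise using left right by blast
qed

lemma glued_leafwise:
  assumes t: "\<And>m. m \<le> n \<Longrightarrow> replete (cat G m m) (side b (t m))"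
  shows "i + symbols P \<le> Suc n \<Longrightarrow> side b (glued G t i P) = leafwise b G t i (i + symbols P - 1)"
proof (induction P arbitrary: i)
  case Sym
  then have i: "i \<le> n" by simp
  have q: "quasicategory (cat G i i)" using cat_quasicategory i by simp
  have S: "side b (t i) \<subseteq> obj (cat G i i)" using t[OF i] unfolding replete_def by blast
  \<comment> \<open>the objects representing x along the identity are those equivalent to x\<close>
  have "(\<exists>y\<in>side b (t i). universal b (cat G i i) (cat G i i) fid x y) \<longleftrightarrow> x \<in> side b (t i)"
    if x: "x \<in> obj (cat G i i)" for x
  proof
    assume "\<exists>y\<in>side b (t i). universal b (cat G i i) (cat G i i) fid x y"
    then obtain y where y: "y \<in> side b (t i)" "universal b (cat G i i) (cat G i i) fid x y" by blast
    have "equivalent (cat G i i) y x"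
      using universal_unique[OF q q smap_fid y(2) universal_fid[OF q x]] .
    then show "x \<in> side b (t i)" using t[OF i] y(1) x unfolding replete_def by blast
  next
    assume "x \<in> side b (t i)"
    then show "\<exists>y\<in>side b (t i). universal b (cat G i i) (cat G i i) fid x y"
      using universal_fid[OF q x] by blast
  qed
  moreover have "fid 0 x = x" for x :: 'a by (simp add: fid_def)
  ultimately show ?case using S by (auto simp: leafwise_def)
next
  case (Pair P Q)
  have pos: "0 < symbols R" for R by (induction R) auto
  let ?j = "i + symbols P - 1" and ?k = "i + symbols P + symbols Q - 1"
  have j: "i + symbols P = Suc ?j" "i \<le> ?j" "?j < ?k" "?k \<le> n"
    using pos[of P] pos[of Q] Pair.prems by auto
  have "side b (glued G t i P) = leafwise b G t i ?j"
    using Pair.IH(1)[of i] Pair.prems by simp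
  moreover have "side b (glued G t (i + symbols P) Q) = leafwise b G t (Suc ?j) ?k"
    using Pair.IH(2)[of "i + symbols P"] Pair.prems j(1) by simp
  ultimately show ?case
    using glue_leafwise[OF j(2-4) t] by (simp add: Let_def add.assoc)
qed

end

theorem theorem4p8:
  fixes n :: nat and G :: "'a compass" and t :: "nat \<Rightarrow> 'a tpair" and P Q :: paren
  assumes "n \<ge> 2"
    and "urizen_compass n G"
    and "\<And>i. i \<le> n \<Longrightarrow> t_structure (cat G i i) (t i)"
    and "symbols P = n + 1" and "symbols Q = n + 1"
  shows "glued G t 0 P = glued G t 0 Q"
proof -
  have t: "replete (cat G m m) (side b (t m))" if "m \<le> n" for b m
    using assms(3)[OF that] by (auto simp: t_structure_def side_def split: prod.splits)
  have "side b (glued G t 0 R) = leafwise b G t 0 n" if "symbols R = n + 1" for b R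
    using glued_leafwise[OF assms(2) t, where i = 0 and P = R] that by simp
  then have "side b (glued G t 0 P) = side b (glued G t 0 Q)" for b
    using assms(4,5) by simp
  from this[of True] this[of False] show ?thesis by (simp add: side_def prod_eq_iff)
qed

end
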